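(* (ZFC) For every singular cardinal $\mu$ and every sequence $\bar p=\langle p_\delta:\delta<\operatorname{cf}(\mu)\rangle$ of partitions $p_\delta:[\mu^+]^2\to n_\delta$ with $n_\delta<\omega$, $\Pr_1(\mu^+,\mu^+,\operatorname{cf}(\mu),\operatorname{cf}(\mu))_{\bar p}$ holds.
   Context: $\Pr_1(\kappa,\mu,\lambda,\chi)_p$ for $p:[\kappa]^2\to\theta$: there is $f:[\kappa]^2\to\lambda$ such that for every $\xi<\chi$, every family $\mathcal A\subseteq[\kappa]^{<\xi}$ of $\mu$ pairwise disjoint nonempty sets, and every $\zeta\in\lambda^\theta$, there are $a,b\in\mathcal A$ with $\max a<\min b$ and $f(\alpha,\beta)=\zeta(p(\alpha,\beta))$ for all $\alpha\in a,\beta\in b$. With a sequence $\bar p=\langle p_\delta\rangle$: a single $f$ witnesses this for every $p_\delta$. *)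

theory Defs
  imports Main
begin

unbundle cardinal_syntax

text \<open>Cardinals are represented, as in the BNF cardinal library of Main, by cardinal
well-orders (Card_order).  An ordinal kappa is the order type of a well-order k;
its elements are Field k, and alpha < beta means (alpha, beta) in k with alpha ~= beta.\<close>

definition has_cf_card :: "'a rel \<Rightarrow> 'b set \<Rightarrow> bool" where
  "has_cf_card r X \<equiv>
     (\<exists>K. K \<subseteq> Field r \<and> cofinal K r \<and> card_of K =o card_of X) \<and>
     (\<forall>K. K \<subseteq> Field r \<and> cofinal K r \<longrightarrow> card_of X \<le>o card_of K)"

definition ord_less :: "'k rel \<Rightarrow> 'k \<Rightarrow> 'k \<Rightarrow> bool" where
  "ord_less k \<alpha> \<beta> \<equiv> (\<alpha>, \<beta>) \<in> k \<and> \<alpha> \<noteq> \<beta>"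

text \<open>Pr_1(kappa, mu, lambda, chi)_pbar for a sequence pbar = (p_delta)_{delta in D},
p_delta : [kappa]^2 -> n_delta.  kappa is given by the well-order k, mu by the
relation m (only its cardinality matters), lambda by the set of colours L, chi by the
well-order x (xi < chi ranges over Field x; "|a| < xi" compares |a| with the
initial segment of x below xi).\<close>
definition Pr1_seq ::
  "'k rel \<Rightarrow> 'm rel \<Rightarrow> 'l set \<Rightarrow> 'x rel \<Rightarrow> ('d \<Rightarrow> 'k \<Rightarrow> 'k \<Rightarrow> nat) \<Rightarrow> ('d \<Rightarrow> nat) \<Rightarrow> 'd set \<Rightarrow> bool"
  where
  "Pr1_seq k m L x p n D \<equiv>
     \<exists>f :: 'k \<Rightarrow> 'k \<Rightarrow> 'l.
       (\<forall>\<alpha>\<in>Field k. \<forall>\<beta>\<in>Field k. ord_less k \<alpha> \<beta> \<longrightarrow> f \<alpha> \<beta> \<in> L) \<and>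
       (\<forall>\<delta>\<in>D. \<forall>\<xi>\<in>Field x. \<forall>A :: 'k set set.
          (\<forall>a\<in>A. a \<subseteq> Field k \<and> card_of a <o Restr x (underS x \<xi>)) \<and>
          card_of A =o m \<and> pairwise disjnt A \<and> {} \<notin> A \<longrightarrow>
          (\<forall>\<zeta> :: nat \<Rightarrow> 'l. \<zeta> ` {..<n \<delta>} \<subseteq> L \<longrightarrow>
             (\<exists>a\<in>A. \<exists>b\<in>A.
                (\<forall>\<alpha>\<in>a. \<forall>\<beta>\<in>b. ord_less k \<alpha> \<beta> \<and> f \<alpha> \<beta> = \<zeta> (p \<delta> \<alpha> \<beta>)))))"

end

theory Submission
  imports Defs
begin

text \<open>
  Colouring pairs by codes \<open>(\<delta>, zs)\<close> of an index \<open>\<delta>\<close> and a finite list \<open>zs\<close> of colours, and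
  then reading off the entry of \<open>zs\<close> at \<open>p \<delta> \<alpha> \<beta>\<close>, reduces the statement to Shelah's
  \<open>Pr\<^sub>1(\<mu>\<^sup>+, \<mu>\<^sup>+, cf \<mu>, cf \<mu>)\<close>.  For the latter take a scale: functions \<open>f\<^sub>\<alpha>\<close> (\<open>\<alpha> < \<mu>\<^sup>+\<close>) on
  \<open>\<kappa> = cf \<mu>\<close>, increasing and cofinal modulo bounded sets below some \<open>h\<close> with
  \<open>cf (h i)\<close> increasing to \<open>\<mu>\<close>.  Colour \<open>\<alpha> < \<beta>\<close> by the last \<open>i\<close> at which \<open>f\<^sub>\<alpha> < f\<^sub>\<beta>\<close> fails.
  Given a large family, choose for each \<open>i\<close> and \<open>\<gamma> < h i\<close> a member \<open>a\<close> on which the functions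
  exceed \<open>\<gamma>\<close> at \<open>i\<close>; one \<open>g\<close> below \<open>h\<close> bounds all of these at the coordinates after \<open>i\<close>, since
  \<open>cf (h j)\<close> outgrows \<open>h i\<close> for \<open>i < j\<close>.  A member \<open>b\<close> lying above \<open>g\<close> from some point on
  then forms with a suitable \<open>a\<close> a rectangle of constant colour \<open>i\<close>, for every large \<open>i\<close>.

  The scale comes from an increasing sequence of length \<open>\<mu>\<^sup>+\<close> in a product of regular cardinals
  whose member at \<open>\<delta>\<close> dominates the supremum over a small club of \<open>\<delta>\<close>.  Club guessing yields
  strongly increasing subsequences inside every unbounded set; these bound projections to small sets,
  and hence give an exact least upper bound of large cofinalities.
\<close>

section \<open>Cofinalities and clubs in a well-ordered type\<close>

text \<open>For infinite \<open>Z\<close> this says that the cofinality of \<open>s\<close> exceeds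
  the cardinality of \<open>Z\<close>. The case of empty \<open>B\<close> also yields a point below
  \<open>s\<close>.\<close>

definition cf_gt :: "'b set \<Rightarrow> 'k::wellorder \<Rightarrow> bool" where
  "cf_gt Z s \<longleftrightarrow> (\<forall>B\<subseteq>{..<s}. |B| \<le>o |Z| \<longrightarrow> (\<exists>x<s. \<forall>b\<in>B. b < x))"

lemma cf_gtD:
  assumes "cf_gt Z s" "|J| \<le>o |Z|" "\<And>j. j \<in> J \<Longrightarrow> g j < s"
  shows "\<exists>x<s. \<forall>j\<in>J. g j < x"
proof -
  have "g ` J \<subseteq> {..<s}" using assms(3) by auto
  moreover have "|g ` J| \<le>o |Z|" using card_of_image assms(2) ordLeq_transitive by blast
  ultimately obtain x where "x < s" "\<forall>b\<in>g ` J. b < x"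
    using assms(1) unfolding cf_gt_def by meson
  then show ?thesis by auto
qed

lemma cf_gt_mono: "cf_gt Z s \<Longrightarrow> |Y| \<le>o |Z| \<Longrightarrow> cf_gt Y s"
  unfolding cf_gt_def by (meson ordLeq_transitive)

lemma cf_gt_limit:
  assumes "cf_gt Z s" "infinite Z" "x < s"
  shows "\<exists>y<s. x < y"
proof -
  have "Z \<noteq> {}" using assms(2) by auto
  then show ?thesis
    using cf_gtD[OF assms(1) card_of_singl_ordLeq, of x id] assms(3) by auto
qed

lemma card_of_lessThan_mono: "x \<le> y \<Longrightarrow> |{..<x::'k::wellorder}| \<le>o |{..<y::'k}|"
  by (intro card_of_mono1) auto

lemma less_of_card_less: "|{..<x::'k::wellorder}| <o |{..<y::'k}| \<Longrightarrow> x < y"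
  by (meson card_of_lessThan_mono not_ordLess_ordLeq not_less)

lemma card_of_insert_ordLeq: "infinite Z \<Longrightarrow> |A| \<le>o |Z| \<Longrightarrow> |insert a A| \<le>o |Z|"
proof -
  assume Z: "infinite Z" "|A| \<le>o |Z|"
  have "|{a} \<union> A| \<le>o |Z|"
  proof (rule card_of_Un_ordLeq_infinite_Field)
    show "\<not> finite (Field |Z| )" using Z(1) by (simp add: Field_card_of)
    show "|{a}| \<le>o |Z|" using Z(1) by (intro card_of_singl_ordLeq) auto
  qed (use Z card_of_Card_order in auto)
  then show ?thesis by simp
qed

lemma insert_lessThan_atMost: "insert x {..<x::'k::wellorder} = {..x}"
  by auto

lemma card_of_atMost_ordLeq:
  "infinite Z \<Longrightarrow> |{..<x::'k::wellorder}| \<le>o |Z| \<Longrightarrow> |{..x}| \<le>o |Z|"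
  using card_of_insert_ordLeq[of Z "{..<x}" x] by (simp add: insert_lessThan_atMost)

lemma card_of_nat_ordLeq: "infinite Z \<Longrightarrow> |UNIV :: nat set| \<le>o |Z|"
  by (simp add: infinite_iff_card_of_nat)

lemma finite_card_less: "finite A \<Longrightarrow> infinite B \<Longrightarrow> |A| <o |B|"
  by (rule finite_ordLess_infinite) (simp_all add: card_of_well_order_on Field_card_of)

text \<open>Otherwise \<open>A\<close> would be a union of at most \<open>|Z|\<close> fibres, each
  of size at most \<open>|Z|\<close>.\<close>

lemma pigeonhole_card:
  assumes "infinite Z" "|Z| <o |A|" "|J| \<le>o |Z|" "\<And>a. a \<in> A \<Longrightarrow> g a \<in> J"
  shows "\<exists>j\<in>J. |Z| <o |{a\<in>A. g a = j}|"
proof (rule ccontr)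
  assume "\<not> ?thesis"
  then have "\<forall>j\<in>J. |{a\<in>A. g a = j}| \<le>o |Z|"
    by (simp add: not_ordLess_iff_ordLeq card_of_Well_order)
  then have "|\<Union>j\<in>J. {a\<in>A. g a = j}| \<le>o |Z|"
    using assms by (intro card_of_UNION_ordLeq_infinite) auto
  moreover have "(\<Union>j\<in>J. {a\<in>A. g a = j}) = A" using assms(4) by auto
  ultimately show False using assms(2) not_ordLess_ordLeq by auto
qed

text \<open>\<open>x\<close> may be any infinite ordinal; \<open>y\<close> is then the initial
  ordinal of the cardinal successor of \<open>|{..<x}|\<close>.\<close>

definition succ_card :: "'k::wellorder \<Rightarrow> 'k \<Rightarrow> bool" where
  "succ_card x y \<longleftrightarrow> infinite {..<x} \<and> |{..<x}| <o |{..<y}| \<and> (\<forall>z<y. |{..<z}| \<le>o |{..<x}| )"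

lemma succ_card_exists:
  fixes x u :: "'k::wellorder"
  assumes "infinite {..<x}" "|{..<x}| <o |{..<u}|"
  shows "\<exists>y\<le>u. succ_card x y"
proof -
  define y where "y = (LEAST y::'k. |{..<x}| <o |{..<y}| )"
  have "|{..<x}| <o |{..<y}|" "y \<le> u" unfolding y_def using assms(2) by (rule LeastI, rule Least_le)
  moreover have "|{..<z}| \<le>o |{..<x}|" if "z < y" for z
    using not_less_Least[OF that[unfolded y_def]] by (simp add: not_ordLess_iff_ordLeq card_of_Well_order)
  ultimately show ?thesis using assms(1) unfolding succ_card_def by auto
qed

text \<open>Successor cardinals are regular: few initial segments of small size have a small union,
  which cannot exhaust \<open>y\<close>.\<close>

lemma succ_card_cf_gt:
  assumes "succ_card x y"
  shows "cf_gt {..<x} y"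
  unfolding cf_gt_def
proof (intro allI impI)
  fix B assume B: "B \<subseteq> {..<y}" "|B| \<le>o |{..<x}|"
  have "\<forall>b\<in>B. |{..b}| \<le>o |{..<x}|"
    using assms B(1) unfolding succ_card_def by (auto intro!: card_of_atMost_ordLeq)
  then have "|\<Union>b\<in>B. {..b}| \<le>o |{..<x}|"
    using assms B unfolding succ_card_def by (intro card_of_UNION_ordLeq_infinite) auto
  then have "\<not> {..<y} \<subseteq> (\<Union>b\<in>B. {..b})"
    using assms unfolding succ_card_def
    by (meson card_of_mono1 not_ordLess_ordLeq ordLeq_transitive)
  then show "\<exists>x<y. \<forall>b\<in>B. b < x" by (auto simp: not_le subset_iff)
qed

lemma succ_card_infinite: "succ_card x y \<Longrightarrow> infinite {..<y}"
  unfolding succ_card_def using card_of_ordLeq_infinite ordLess_imp_ordLeq by blast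

text \<open>Iterate \<omega> times a step that jumps above all values of \<open>\<nu>\<close> at
  arguments up to the present point. The supremum of the iterates is closed under
  \<open>\<nu>\<close> and is a limit; it stays below \<open>s\<close> because the cofinality of
  \<open>s\<close> is uncountable.\<close>

lemma closure_point_exists:
  fixes \<nu> :: "'k::wellorder \<Rightarrow> 'k"
  assumes cf: "cf_gt (UNIV :: nat set) s"
    and bd: "\<And>\<beta>. \<beta> < s \<Longrightarrow> \<exists>x<s. \<forall>j\<le>\<beta>. \<nu> j < x"
    and i0: "i0 < s"
  shows "\<exists>i<s. i0 < i \<and> (\<forall>j<i. \<nu> j < i) \<and> (\<forall>j<i. \<exists>k<i. j < k)"
proof -
  have "\<exists>x<s. \<beta> < x \<and> (\<forall>j\<le>\<beta>. \<nu> j < x)" if \<beta>: "\<beta> < s" for \<beta>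
  proof -
    obtain x where x: "x < s" "\<forall>j\<le>\<beta>. \<nu> j < x" using bd[OF \<beta>] by auto
    obtain y where "y < s" "max x \<beta> < y"
      using cf_gt_limit[OF cf, of "max x \<beta>"] x \<beta> by auto
    then show ?thesis using x by (intro exI[of _ y]) auto
  qed
  then obtain st where st: "\<And>\<beta>. \<beta> < s \<Longrightarrow> st \<beta> < s \<and> \<beta> < st \<beta> \<and> (\<forall>j\<le>\<beta>. \<nu> j < st \<beta>)"
    by metis
  define b where "b n = (st ^^ n) i0" for n
  have bs: "b n < s" for n by (induction n) (auto simp: b_def i0 st)
  have bS: "b n < b (Suc n)" "\<forall>j\<le>b n. \<nu> j < b (Suc n)" for n
    using st[OF bs[of n]] by (auto simp: b_def)
  \<comment> \<open>This is the supremum of the iterates, which increase strictly; hence every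
    \<open>j\<close> below it lies below some \<open>b m\<close>, and \<open>b (Suc m)\<close> is
    already above \<open>\<nu> j\<close>.\<close>
  define i where "i = (LEAST x. \<forall>n. b n < x)"
  obtain x where x: "x < s" "\<forall>n. b n < x"
    using cf_gtD[OF cf, of UNIV b] bs ordIso_imp_ordLeq[OF card_of_refl] by blast
  have i: "\<forall>n. b n < i" "i \<le> x" unfolding i_def using x(2) by (rule LeastI, rule Least_le)
  have n: "\<exists>n. j \<le> b n" if j: "j < i" for j
    using not_less_Least[OF that[unfolded i_def]] by (auto simp: not_less)
  have "i0 < i" using i(1)[rule_format, of 0] by (simp add: b_def)
  moreover have "\<nu> j < i \<and> (\<exists>k<i. j < k)" if j: "j < i" for j
  proof -
    obtain m where m: "j \<le> b m" using n[OF j] by blast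
    then have "\<nu> j < b (Suc m)" "j < b (Suc m)" using bS[of m] by auto
    then show ?thesis using i(1) less_trans by blast
  qed
  ultimately show ?thesis using i(2) x(1) by (intro exI[of _ i]) auto
qed

section \<open>Closed unbounded sets\<close>

definition lim_pt :: "'k::wellorder set \<Rightarrow> 'k \<Rightarrow> bool" where
  "lim_pt D x \<longleftrightarrow> (\<exists>y. y < x) \<and> (\<forall>y<x. \<exists>d\<in>D. y < d \<and> d < x)"

definition club :: "'k::wellorder \<Rightarrow> 'k set \<Rightarrow> bool" where
  "club s D \<longleftrightarrow> D \<subseteq> {..<s} \<and> (\<forall>x<s. \<exists>d\<in>D. x < d) \<and> (\<forall>x<s. lim_pt D x \<longrightarrow> x \<in> D)"

lemma lim_pt_mono: "lim_pt D x \<Longrightarrow> D \<subseteq> E \<Longrightarrow> lim_pt E x"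
  unfolding lim_pt_def by blast

lemma club_lessThan: "infinite Z \<Longrightarrow> cf_gt Z s \<Longrightarrow> club s {..<s}"
  unfolding club_def using cf_gt_limit by blast

text \<open>Let \<open>\<nu> x\<close> lie beyond some point above \<open>x\<close> of each
  \<open>D j\<close>. A point closed under \<open>\<nu>\<close> is a limit of every
  \<open>D j\<close>, hence in all of them. The assumption \<open>small\<close> makes
  \<open>\<nu>\<close> bounded on initial segments, so that such points exist.\<close>

lemma club_INT:
  fixes D :: "'j \<Rightarrow> 'k::wellorder set"
  assumes Z: "infinite Z" "cf_gt Z s" and small: "\<And>\<beta>. \<beta> < s \<Longrightarrow> |{..<\<beta>}| \<le>o |Z|"
    and J: "|J| \<le>o |Z|" "J \<noteq> {}" and cl: "\<And>j. j \<in> J \<Longrightarrow> club s (D j)"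
  shows "club s (\<Inter>j\<in>J. D j)"
proof -
  have "\<exists>y<s. \<forall>j\<in>J. \<exists>d\<in>D j. x < d \<and> d < y" if "x < s" for x
  proof -
    have "\<exists>d. d \<in> D j \<and> x < d \<and> d < s" if "j \<in> J" for j
      using cl[OF that] \<open>x < s\<close> unfolding club_def by blast
    then obtain d where d: "\<And>j. j \<in> J \<Longrightarrow> d j \<in> D j \<and> x < d j \<and> d j < s" by metis
    then show ?thesis using cf_gtD[OF Z(2) J(1), of d] by metis
  qed
  then obtain \<nu> where \<nu>: "\<And>x. x < s \<Longrightarrow> \<nu> x < s \<and> (\<forall>j\<in>J. \<exists>d\<in>D j. x < d \<and> d < \<nu> x)"
    by metis
  have unb: "\<exists>d\<in>(\<Inter>j\<in>J. D j). i0 < d" if i0: "i0 < s" for i0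
  proof -
    have "\<exists>x<s. \<forall>j\<le>\<beta>. \<nu> j < x" if "\<beta> < s" for \<beta>
      using cf_gtD[OF Z(2) card_of_atMost_ordLeq[OF Z(1) small[OF that]], of \<nu>] \<nu> that by auto
    then obtain i where i: "i < s" "i0 < i" "\<forall>j<i. \<nu> j < i"
      using closure_point_exists[OF cf_gt_mono[OF Z(2) card_of_nat_ordLeq[OF Z(1)]], of \<nu> i0] i0
      by blast
    have "lim_pt (D j) i" if "j \<in> J" for j
      unfolding lim_pt_def using i \<nu> that by (metis less_trans)
    then have "i \<in> D j" if "j \<in> J" for j using cl[OF that] that i(1) unfolding club_def by blast
    then show ?thesis using i(2) by blast
  qed
  have "x \<in> D j" if "x < s" "lim_pt (\<Inter>j\<in>J. D j) x" "j \<in> J" for x j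
    using lim_pt_mono[OF that(2), of "D j"] cl[OF that(3)] that(1,3) unfolding club_def by blast
  moreover have "(\<Inter>j\<in>J. D j) \<subseteq> {..<s}" using J(2) cl unfolding club_def by blast
  ultimately show ?thesis using unb unfolding club_def by simp
qed

text \<open>The least upper bound of the part of \<open>D\<close> up to \<open>\<gamma>\<close>
  would be a limit point of \<open>D\<close> if it were not in \<open>D\<close>; closedness then
  puts it there. The point \<open>d0\<close> keeps that part nonempty.\<close>

lemma club_last_below:
  assumes "club s D" "d0 \<in> D" "d0 \<le> \<gamma>" "\<gamma> < s"
  shows "\<exists>m\<in>D. m \<le> \<gamma> \<and> (\<forall>d\<in>D. d \<le> \<gamma> \<longrightarrow> d \<le> m)"
proof -
  define m where "m = (LEAST x. \<forall>d\<in>D. d \<le> \<gamma> \<longrightarrow> d \<le> x)"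
  have m: "\<forall>d\<in>D. d \<le> \<gamma> \<longrightarrow> d \<le> m" "m \<le> \<gamma>"
    unfolding m_def by (rule LeastI[of _ \<gamma>], simp) (rule Least_le, simp)
  have "m \<in> D"
  proof (rule ccontr)
    assume nm: "m \<notin> D"
    have "\<exists>d\<in>D. y < d \<and> d < m" if "y < m" for y
      using not_less_Least[OF that[unfolded m_def]] m(1) nm by (metis not_le order.not_eq_order_implies_strict)
    moreover have "d0 < m" using m(1) assms(2,3) nm by (metis order.not_eq_order_implies_strict)
    ultimately have "lim_pt D m" unfolding lim_pt_def by blast
    then show False using assms(1,4) m(2) nm unfolding club_def by (meson le_less_trans)
  qed
  then show ?thesis using m by blast
qed

text \<open>The least value attained below \<open>s\<close> can never be left again.\<close>

lemma antimono_stabilises: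
  fixes g :: "'k::wellorder \<Rightarrow> 'l::wellorder"
  assumes "\<And>x y. x \<le> y \<Longrightarrow> y < s \<Longrightarrow> g y \<le> g x" "z < s"
  shows "\<exists>x<s. \<forall>y. x \<le> y \<longrightarrow> y < s \<longrightarrow> g y = g x"
proof -
  define v where "v = (LEAST v. \<exists>x<s. g x = v)"
  have "\<exists>x<s. g x = v" unfolding v_def by (rule LeastI[of _ "g z"]) (use assms(2) in blast)
  then obtain x where x: "x < s" "g x = v" by blast
  have "v \<le> g y" if "y < s" for y unfolding v_def using that by (auto intro: Least_le)
  then have "g y = g x" if "x \<le> y" "y < s" for y
    using assms(1)[OF that] x that by (metis antisym)
  then show ?thesis using x(1) by blast
qed

lemma not_card_le_if_cofinal:
  assumes "cf_gt Z s" "B \<subseteq> {..<s}" "\<And>y. y < s \<Longrightarrow> \<exists>b\<in>B. y \<le> b"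
  shows "|Z| <o |B|"
proof (rule ccontr)
  assume "\<not> ?thesis"
  then have "|B| \<le>o |Z|" by (simp add: not_ordLess_iff_ordLeq card_of_Well_order)
  then obtain x where "x < s" "\<forall>b\<in>B. b < x" using assms(1,2) unfolding cf_gt_def by meson
  then show False using assms(3)[of x] by auto
qed

section \<open>Club guessing\<close>

text \<open>Take \<open>R\<close> inside \<open>D\<close> of size \<open>|{..<\<chi>}|\<close> and
  let \<open>\<alpha>\<close> be the least point below which \<open>R\<close> has more than
  \<open>|{..<\<theta>}|\<close> elements. A cofinal subset of \<open>\<alpha>\<close> of size at
  most \<open>|{..<\<theta>}|\<close> would cover this part of \<open>R\<close> by too few sets that
  are too small.\<close>

lemma club_limit_of_cf:
  fixes \<theta> \<chi> \<sigma> :: "'k::wellorder"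
  assumes sc: "succ_card \<theta> \<chi>" and cf: "cf_gt {..<\<chi>} \<sigma>" and D: "club \<sigma> D"
  shows "\<exists>\<alpha><\<sigma>. cf_gt {..<\<theta>} \<alpha> \<and> (\<exists>Q\<subseteq>D \<inter> {..<\<alpha>}. |Q| \<le>o |{..<\<chi>}| \<and> (\<forall>y<\<alpha>. \<exists>q\<in>Q. y < q))"
proof -
  have inf: "infinite {..<\<theta>}" using sc by (simp add: succ_card_def)
  have "|{..<\<chi>}| <o |D|"
    using not_card_le_if_cofinal[OF cf, of D] D unfolding club_def by (meson less_imp_le)
  then obtain g where g: "inj_on g {..<\<chi>}" "g ` {..<\<chi>} \<subseteq> D"
    using card_of_ordLeq ordLess_imp_ordLeq by metis
  define R where "R = g ` {..<\<chi>}"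
  have Rle: "|R| \<le>o |{..<\<chi>}|" unfolding R_def by (rule card_of_image)
  have Rge: "|{..<\<chi>}| \<le>o |R|" unfolding R_def using g(1) card_of_ordLeq by blast
  have RD: "R \<subseteq> D" "R \<subseteq> {..<\<sigma>}" using g(2) D by (auto simp: R_def club_def)
  obtain u where u: "u < \<sigma>" "\<forall>b\<in>R. b < u"
    using cf RD(2) Rle unfolding cf_gt_def by meson
  define \<alpha> where "\<alpha> = (LEAST x. |{..<\<theta>}| <o |R \<inter> {..<x}| )"
  have "R \<inter> {..<u} = R" using u(2) by auto
  then have "|{..<\<theta>}| <o |R \<inter> {..<u}|"
    using sc Rge ordLess_ordLeq_trans unfolding succ_card_def by auto
  then have \<alpha>: "|{..<\<theta>}| <o |R \<inter> {..<\<alpha>}|" "\<alpha> \<le> u"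
    unfolding \<alpha>_def by (rule LeastI, rule Least_le)
  have below: "|R \<inter> {..y}| \<le>o |{..<\<theta>}|" if "y < \<alpha>" for y
  proof -
    have "|R \<inter> {..<y}| \<le>o |{..<\<theta>}|"
      using not_less_Least[OF that[unfolded \<alpha>_def]]
      by (simp add: not_ordLess_iff_ordLeq card_of_Well_order)
    then have "|insert y (R \<inter> {..<y})| \<le>o |{..<\<theta>}|" by (rule card_of_insert_ordLeq[OF inf])
    moreover have "|R \<inter> {..y}| \<le>o |insert y (R \<inter> {..<y})|" by (intro card_of_mono1) auto
    ultimately show ?thesis using ordLeq_transitive by blast
  qed
  have cof: "\<exists>q\<in>R \<inter> {..<\<alpha>}. y < q" if "y < \<alpha>" for y
  proof (rule ccontr)
    assume "\<not> ?thesis"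
    then have "R \<inter> {..<\<alpha>} \<subseteq> R \<inter> {..y}" using not_less by blast
    then have "|R \<inter> {..<\<alpha>}| \<le>o |{..<\<theta>}|" using below[OF that] card_of_mono1 ordLeq_transitive by blast
    then show False using \<alpha>(1) not_ordLess_ordLeq by blast
  qed
  have "cf_gt {..<\<theta>} \<alpha>" unfolding cf_gt_def
  proof (intro allI impI, rule ccontr)
    fix B assume B: "B \<subseteq> {..<\<alpha>}" "|B| \<le>o |{..<\<theta>}|" "\<not> (\<exists>x<\<alpha>. \<forall>b\<in>B. b < x)"
    have "R \<inter> {..<\<alpha>} \<subseteq> (\<Union>b\<in>B. R \<inter> {..b})" using B(3) by (intro subsetI) (metis Int_iff UN_iff atMost_iff lessThan_iff not_less)
    moreover have "|\<Union>b\<in>B. R \<inter> {..b}| \<le>o |{..<\<theta>}|"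
      using B(1,2) below inf by (intro card_of_UNION_ordLeq_infinite) auto
    ultimately have "|R \<inter> {..<\<alpha>}| \<le>o |{..<\<theta>}|" using card_of_mono1 ordLeq_transitive by blast
    then show False using \<alpha>(1) not_ordLess_ordLeq by blast
  qed
  moreover have "|R \<inter> {..<\<alpha>}| \<le>o |{..<\<chi>}|"
    using Rle card_of_mono1[of "R \<inter> {..<\<alpha>}" R] ordLeq_transitive by blast
  moreover have "\<alpha> < \<sigma>" using \<alpha>(2) u(1) by simp
  ultimately show ?thesis using cof RD(1)
    by (intro exI[of _ \<alpha>] conjI exI[of _ "R \<inter> {..<\<alpha>}"]) auto
qed

text \<open>Replacing each point of a candidate by the last point of the club below it only moves points
  down, so shrinking the club \<open>\<rho>\<close> many times must stabilise; the stable candidate lies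
  inside the next club.\<close>

lemma club_guessing:
  fixes \<theta> \<chi> \<rho> \<sigma> e :: "'k::wellorder"
  assumes sc: "succ_card \<theta> \<chi>" "succ_card \<chi> \<rho>" "succ_card \<rho> \<sigma>" and e: "\<And>x. e \<le> x"
  shows "\<exists>C. \<forall>D. club \<sigma> D \<and> e \<in> D \<longrightarrow> (\<exists>\<alpha><\<sigma>. C \<alpha> \<subseteq> D \<and> |{..<\<theta>}| <o |C \<alpha>| )"
proof (rule ccontr)
  assume nC: "\<not> ?thesis"
  have inf: "infinite {..<\<theta>}" "infinite {..<\<chi>}" "infinite {..<\<rho>}"
    using sc by (auto simp: succ_card_def)
  have cf: "cf_gt {..<\<theta>} \<chi>" "cf_gt {..<\<chi>} \<rho>" "cf_gt {..<\<rho>} \<sigma>"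
    using sc by (auto intro: succ_card_cf_gt)
  have cf': "cf_gt {..<\<chi>} \<sigma>"
    using cf_gt_mono[OF cf(3)] sc(2) ordLess_imp_ordLeq unfolding succ_card_def by blast
  have small: "|{..<\<beta>}| \<le>o |{..<\<rho>}|" if "\<beta> < \<sigma>" for \<beta> using sc(3) that by (auto simp: succ_card_def)
  define good where "good \<alpha> Q \<longleftrightarrow> Q \<subseteq> {..<\<alpha>} \<and> |Q| \<le>o |{..<\<chi>}| \<and> (\<forall>y<\<alpha>. \<exists>q\<in>Q. y < q)"
    for \<alpha> :: 'k and Q
  \<comment> \<open>One candidate per \<open>\<alpha>\<close>, fixed before any club is considered;
    the clubs only alter it through \<open>lst\<close>.\<close>
  define Q where "Q \<alpha> = (SOME Q. good \<alpha> Q)" for \<alpha>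
  define lst where "lst D \<gamma> = (SOME m. m \<in> D \<and> m \<le> \<gamma> \<and> (\<forall>d\<in>D. d \<le> \<gamma> \<longrightarrow> d \<le> m))"
    for D and \<gamma> :: 'k
  define ok where "ok D \<longleftrightarrow> club \<sigma> D \<and> e \<in> D" for D
  have lst: "lst D \<gamma> \<in> D \<and> lst D \<gamma> \<le> \<gamma> \<and> (\<forall>d\<in>D. d \<le> \<gamma> \<longrightarrow> d \<le> lst D \<gamma>)" if "ok D" "\<gamma> < \<sigma>" for D \<gamma>
  proof -
    have "\<exists>m. m \<in> D \<and> m \<le> \<gamma> \<and> (\<forall>d\<in>D. d \<le> \<gamma> \<longrightarrow> d \<le> m)"
      using club_last_below[of \<sigma> D e \<gamma>] that e unfolding ok_def by blast
    then show ?thesis unfolding lst_def by (rule someI_ex)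
  qed
  have "\<exists>G. ok G \<and> (\<forall>\<alpha><\<sigma>. \<not> (lst D ` Q \<alpha> \<subseteq> G \<and> |{..<\<theta>}| <o |lst D ` Q \<alpha>| ))" for D
  proof -
    have "\<not> (\<forall>G. club \<sigma> G \<and> e \<in> G \<longrightarrow>
        (\<exists>\<alpha><\<sigma>. lst D ` Q \<alpha> \<subseteq> G \<and> |{..<\<theta>}| <o |lst D ` Q \<alpha>| ))"
      using nC by (rule contrapos_nn) (rule exI)
    then show ?thesis unfolding ok_def by blast
  qed
  then obtain G where GG: "\<And>D. ok (G D) \<and> (\<forall>\<alpha><\<sigma>. \<not> (lst D ` Q \<alpha> \<subseteq> G D \<and> |{..<\<theta>}| <o |lst D ` Q \<alpha>| ))"
    using choice[of "\<lambda>D G. ok G \<and> (\<forall>\<alpha><\<sigma>. \<not> (lst D ` Q \<alpha> \<subseteq> G \<and> |{..<\<theta>}| <o |lst D ` Q \<alpha>| ))"]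
    by meson
  then have G: "ok (G D)"
    and nG: "\<alpha> < \<sigma> \<Longrightarrow> lst D ` Q \<alpha> \<subseteq> G D \<Longrightarrow> \<not> |{..<\<theta>}| <o |lst D ` Q \<alpha>|" for D \<alpha>
    by blast+
  \<comment> \<open>A decreasing sequence of clubs, each contained in the counterexamples to all
    earlier ones. Inserting \<open>{..<\<sigma>}\<close> gives the intersection its value at the
    least index.\<close>
  have "\<exists>f. \<forall>x::'k. f x = \<Inter>(insert {..<\<sigma>} ((\<lambda>y. G (f y)) ` {..<x}))"
    by (rule dependent_wellorder_choice[where P = "\<lambda>f x r. r = \<Inter>(insert {..<\<sigma>} ((\<lambda>y. G (f y)) ` {..<x}))"]) auto
  then obtain f :: "'k \<Rightarrow> 'k set"
    where f: "\<And>x. f x = \<Inter>(insert {..<\<sigma>} ((\<lambda>y. G (f y)) ` {..<x}))" by metis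
  have okf: "ok (f x)" if "x \<le> \<rho>" for x
  proof -
    have "|(\<lambda>y. G (f y)) ` {..<x}| \<le>o |{..<\<rho>}|"
      using card_of_image card_of_lessThan_mono[OF that] ordLeq_transitive by blast
    then have "|insert {..<\<sigma>} ((\<lambda>y. G (f y)) ` {..<x})| \<le>o |{..<\<rho>}|"
      by (rule card_of_insert_ordLeq[OF inf(3)])
    then have "club \<sigma> (\<Inter>X\<in>insert {..<\<sigma>} ((\<lambda>y. G (f y)) ` {..<x}). X)"
      using G club_lessThan[OF inf(3) cf(3)] unfolding ok_def
      by (intro club_INT[OF inf(3) cf(3) small]) auto
    moreover have "e < \<sigma>"
      using sc(3) e by (metis le_less_trans less_of_card_less succ_card_def)
    then have "e \<in> f x" using G by (subst f) (auto simp: ok_def)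
    ultimately show ?thesis unfolding ok_def by (subst f) simp
  qed
  have f_anti: "f y \<subseteq> f x" if "x \<le> y" for x y
    unfolding f[of x] f[of y] using that by (auto intro: less_le_trans)
  have f_sub: "f y \<subseteq> G (f x)" if "x < y" for x y
    unfolding f[of y] using that by auto
  \<comment> \<open>\<open>f \<rho>\<close> lies inside all earlier clubs. A limit
    \<open>\<alpha>\<close> of it of large cofinality shows that a good candidate at
    \<open>\<alpha>\<close> exists, so \<open>Q \<alpha>\<close> is one.\<close>
  obtain \<alpha> Q0 where \<alpha>: "\<alpha> < \<sigma>" "cf_gt {..<\<theta>} \<alpha>" and Q0: "Q0 \<subseteq> f \<rho> \<inter> {..<\<alpha>}" "good \<alpha> Q0"
    using club_limit_of_cf[OF sc(1) cf', of "f \<rho>"] okf[of \<rho>] unfolding ok_def good_def by fastforce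
  have Q: "good \<alpha> (Q \<alpha>)" unfolding Q_def using Q0(2) by (rule someI)
  have Qs: "\<gamma> < \<sigma>" if "\<gamma> \<in> Q \<alpha>" for \<gamma> using that Q \<alpha>(1) unfolding good_def by auto
  have "e < \<rho>" using sc(2) e by (metis le_less_trans less_of_card_less succ_card_def)
  have "\<exists>x<\<rho>. \<forall>y. x \<le> y \<longrightarrow> y < \<rho> \<longrightarrow> lst (f y) \<gamma> = lst (f x) \<gamma>" if "\<gamma> \<in> Q \<alpha>" for \<gamma>
  proof (rule antimono_stabilises)
    fix x y assume "x \<le> y" "y < \<rho>"
    then have "x \<le> \<rho>" "y \<le> \<rho>" "f y \<subseteq> f x" using f_anti by auto
    then show "lst (f y) \<gamma> \<le> lst (f x) \<gamma>"
      using lst[OF okf[of x] Qs[OF that]] lst[OF okf[of y] Qs[OF that]] by blast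
  qed (fact \<open>e < \<rho>\<close>)
  then obtain st where st: "\<And>\<gamma>. \<gamma> \<in> Q \<alpha> \<Longrightarrow> st \<gamma> < \<rho>"
      "\<And>\<gamma> y. \<gamma> \<in> Q \<alpha> \<Longrightarrow> st \<gamma> \<le> y \<Longrightarrow> y < \<rho> \<Longrightarrow> lst (f y) \<gamma> = lst (f (st \<gamma>)) \<gamma>" by metis
  \<comment> \<open>At most \<open>|{..<\<chi>}|\<close> points have to stabilise and the cofinality
    of \<open>\<rho>\<close> is larger, so one stage serves them all.\<close>
  obtain x where x: "x < \<rho>" "\<forall>\<gamma>\<in>Q \<alpha>. st \<gamma> < x"
    using cf_gtD[OF cf(2), of "Q \<alpha>" st] Q st(1) unfolding good_def by blast
  obtain y where y: "y < \<rho>" "x < y" using cf_gt_limit[OF cf(2) inf(2) x(1)] by blast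
  have "lst (f x) \<gamma> \<in> G (f x)" if "\<gamma> \<in> Q \<alpha>" for \<gamma>
  proof -
    have "lst (f x) \<gamma> = lst (f y) \<gamma>" using st(2)[OF that] x y that by (metis less_imp_le less_trans)
    also have "\<dots> \<in> f y" using lst[OF okf Qs[OF that]] y(1) by auto
    finally show ?thesis using f_sub[OF y(2)] by auto
  qed
  then have sub: "lst (f x) ` Q \<alpha> \<subseteq> G (f x)" by auto
  have lx: "lst (f x) \<gamma> \<le> \<gamma>" "\<And>d. d \<in> f x \<Longrightarrow> d \<le> \<gamma> \<Longrightarrow> d \<le> lst (f x) \<gamma>" if "\<gamma> \<in> Q \<alpha>" for \<gamma>
    using lst[OF okf Qs[OF that], of x] x(1) by auto
  \<comment> \<open>The modified candidate is still cofinal in \<open>\<alpha>\<close>: a point of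
    \<open>Q0\<close> below \<open>\<gamma>\<close> belongs to \<open>f x\<close> and bounds
    \<open>lst (f x) \<gamma>\<close> from below.\<close>
  have "|{..<\<theta>}| <o |lst (f x) ` Q \<alpha>|"
  proof (rule not_card_le_if_cofinal[OF \<alpha>(2)])
    show "lst (f x) ` Q \<alpha> \<subseteq> {..<\<alpha>}"
      using lx(1) Q unfolding good_def by (force intro: le_less_trans)
    fix v assume v: "v < \<alpha>"
    then obtain d where d: "d \<in> Q0" "v < d" using Q0(2) unfolding good_def by blast
    then have "d < \<alpha>" "d \<in> f x" using Q0(1) f_anti[OF less_imp_le[OF x(1)]] by auto
    moreover then obtain \<gamma> where "\<gamma> \<in> Q \<alpha>" "d < \<gamma>" using Q unfolding good_def by blast
    ultimately have "d \<le> lst (f x) \<gamma>" "\<gamma> \<in> Q \<alpha>" using lx(2)[of \<gamma> d] by auto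
    then have "v \<le> lst (f x) \<gamma>" "\<gamma> \<in> Q \<alpha>" using d(2) by auto
    then show "\<exists>b\<in>lst (f x) ` Q \<alpha>. v \<le> b" by blast
  qed
  then show False using nG[OF \<alpha>(1) sub] by blast
qed

section \<open>An increasing sequence of functions below a singular cardinal\<close>

text \<open>All ordinals are points of one well-ordered type. \<open>\<kappa>\<close> is the
  cofinality of the cardinal \<open>\<mu>\<close>, witnessed by the cofinal map \<open>t\<close>,
  which need not be monotone, and \<open>\<Lambda>\<close> is the successor cardinal of
  \<open>\<mu>\<close>.\<close>

locale singular =
  fixes \<kappa> \<mu> \<Lambda> :: "'k::wellorder" and t :: "'k \<Rightarrow> 'k"
  assumes \<kappa>_infinite: "infinite {..<\<kappa>}"
    and \<kappa>_card: "i < \<kappa> \<Longrightarrow> |{..<i}| <o |{..<\<kappa>}|"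
    and \<kappa>_less: "\<kappa> < \<mu>"
    and \<mu>_card: "x < \<mu> \<Longrightarrow> |{..<x}| <o |{..<\<mu>}|"
    and t_less: "i < \<kappa> \<Longrightarrow> t i < \<mu>"
    and t_cofinal: "x < \<mu> \<Longrightarrow> \<exists>i<\<kappa>. x \<le> t i"
    and \<mu>_cf: "B \<subseteq> {..<\<mu>} \<Longrightarrow> |B| <o |{..<\<kappa>}| \<Longrightarrow> \<exists>x<\<mu>. \<forall>b\<in>B. b < x"
    and \<Lambda>_succ: "succ_card \<mu> \<Lambda>"
begin

lemma \<mu>_infinite: "infinite {..<\<mu>}"
  using \<Lambda>_succ by (simp add: succ_card_def)

lemma \<Lambda>_cf: "cf_gt {..<\<mu>} \<Lambda>"
  using \<Lambda>_succ by (rule succ_card_cf_gt)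

lemma card_le_\<mu>: "x \<le> \<mu> \<Longrightarrow> |{..<x}| \<le>o |{..<\<mu>}|"
  by (rule card_of_lessThan_mono)

text \<open>A singular cardinal is a limit cardinal: otherwise \<open>\<mu>\<close> would be the
  union of \<open>\<kappa>\<close> many segments of size at most
  \<open>|{..<max x \<kappa>}|\<close>.\<close>

lemma \<mu>_limit_card:
  assumes "x < \<mu>"
  shows "\<exists>y<\<mu>. |{..<x}| <o |{..<y}|"
proof (rule ccontr)
  assume "\<not> ?thesis"
  then have le: "|{..<y}| \<le>o |{..<max x \<kappa>}|" if "y < \<mu>" for y
    using that card_of_lessThan_mono[of x "max x \<kappa>"] ordLeq_transitive
    by (metis card_of_Well_order max.cobounded1 not_ordLess_iff_ordLeq)
  have inf: "infinite {..<max x \<kappa>}"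
    using \<kappa>_infinite by (rule contrapos_nn) (auto elim: finite_subset[rotated])
  have "|\<Union>i\<in>{..<\<kappa>}. {..t i}| \<le>o |{..<max x \<kappa>}|"
    using inf le t_less card_of_lessThan_mono[of \<kappa> "max x \<kappa>"]
    by (intro card_of_UNION_ordLeq_infinite ballI card_of_atMost_ordLeq) auto
  moreover have "{..<\<mu>} \<subseteq> (\<Union>i\<in>{..<\<kappa>}. {..t i})" using t_cofinal by auto
  ultimately have "|{..<\<mu>}| \<le>o |{..<max x \<kappa>}|" using card_of_mono1 ordLeq_transitive by blast
  then show False using \<mu>_card[of "max x \<kappa>"] assms \<kappa>_less not_ordLess_ordLeq by auto
qed

lemma succ_below_\<mu>:
  assumes "x < \<mu>" "infinite {..<x}"
  shows "\<exists>y<\<mu>. succ_card x y"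
  using \<mu>_limit_card[OF assms(1)] succ_card_exists[OF assms(2)] by (meson le_less_trans)

lemma card_atMost_\<kappa>: "i < \<kappa> \<Longrightarrow> |{..i}| <o |{..<\<kappa>}|"
proof (cases "finite {..<i}")
  case True
  then have "finite {..i}" by (simp flip: insert_lessThan_atMost)
  then show ?thesis using \<kappa>_infinite by (rule finite_card_less)
next
  case False
  assume "i < \<kappa>"
  then show ?thesis
    using card_of_atMost_ordLeq[OF False ordIso_imp_ordLeq[OF card_of_refl]] \<kappa>_card
      ordLeq_ordLess_trans by blast
qed

text \<open>A nondecreasing majorant of \<open>t\<close> with values at least
  \<open>\<kappa>\<close>; it stays below \<open>\<mu>\<close> because fewer than
  \<open>\<kappa>\<close> values of \<open>t\<close> enter at each \<open>i\<close>.\<close>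

definition T :: "'k \<Rightarrow> 'k" where "T i = (LEAST x. \<kappa> \<le> x \<and> (\<forall>j\<le>i. t j \<le> x))"

lemma T_props:
  assumes "i < \<kappa>"
  shows T_less: "T i < \<mu>" and \<kappa>_le_T: "\<kappa> \<le> T i" and t_le_T: "j \<le> i \<Longrightarrow> t j \<le> T i"
proof -
  have "|t ` {..i}| <o |{..<\<kappa>}|" using card_of_image card_atMost_\<kappa>[OF assms] ordLeq_ordLess_trans by blast
  moreover have "t ` {..i} \<subseteq> {..<\<mu>}" using t_less assms by auto
  ultimately obtain x where x: "x < \<mu>" "\<forall>b\<in>t ` {..i}. b < x" using \<mu>_cf by meson
  have P: "\<kappa> \<le> max x \<kappa> \<and> (\<forall>j\<le>i. t j \<le> max x \<kappa>)" using x(2) by (auto simp: le_max_iff_disj less_imp_le)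
  show "\<kappa> \<le> T i" "j \<le> i \<Longrightarrow> t j \<le> T i" 
    using LeastI[where P = "\<lambda>x. \<kappa> \<le> x \<and> (\<forall>j\<le>i. t j \<le> x)", OF P] unfolding T_def by auto
  have "T i \<le> max x \<kappa>" unfolding T_def using P by (rule Least_le)
  then show "T i < \<mu>" by (rule le_less_trans) (use x(1) \<kappa>_less in simp)
qed

lemma T_infinite: "i < \<kappa> \<Longrightarrow> infinite {..<T i}"
  using \<kappa>_infinite \<kappa>_le_T by (metis finite_subset lessThan_subset_iff)

text \<open>The values of \<open>T\<close> on \<open>B\<close> are bounded by some \<open>y\<close>
  below \<open>\<mu>\<close>. If \<open>y \<le> t i\<close>, no element of \<open>B\<close> can
  reach \<open>i\<close>, since \<open>T\<close> there would be at least \<open>t i\<close>.\<close>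

lemma \<kappa>_regular:
  assumes "B \<subseteq> {..<\<kappa>}" "|B| <o |{..<\<kappa>}|"
  shows "\<exists>x<\<kappa>. \<forall>b\<in>B. b < x"
proof -
  have "|T ` B| <o |{..<\<kappa>}|" using card_of_image assms(2) ordLeq_ordLess_trans by blast
  moreover have "T ` B \<subseteq> {..<\<mu>}" using T_less assms(1) by auto
  ultimately obtain y where y: "y < \<mu>" "\<forall>b\<in>T ` B. b < y" using \<mu>_cf by meson
  obtain i where i: "i < \<kappa>" "y \<le> t i" using t_cofinal[OF y(1)] by blast
  have "b < i" if "b \<in> B" for b
  proof (rule ccontr)
    assume "\<not> b < i"
    then have "t i \<le> T b" using t_le_T[of b i] assms(1) that by auto
    then show False using y(2) that i(2) by force
  qed
  then show ?thesis using i(1) by blast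
qed

lemma \<kappa>_bound:
  assumes "|J| <o |{..<\<kappa>}|" "\<And>j. j \<in> J \<Longrightarrow> g j < \<kappa>"
  shows "\<exists>x<\<kappa>. \<forall>j\<in>J. g j < x"
proof -
  have "|g ` J| <o |{..<\<kappa>}|" using card_of_image assms(1) ordLeq_ordLess_trans by blast
  moreover have "g ` J \<subseteq> {..<\<kappa>}" using assms(2) by auto
  ultimately obtain x where "x < \<kappa>" "\<forall>b\<in>g ` J. b < x" using \<kappa>_regular by meson
  then show ?thesis by auto
qed

lemma finite_less_\<kappa>: "finite J \<Longrightarrow> |J| <o |{..<\<kappa>}|"
  using \<kappa>_infinite by (rule finite_card_less[rotated])

lemma \<kappa>_limit: "i < \<kappa> \<Longrightarrow> \<exists>j<\<kappa>. i < j"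
  using \<kappa>_bound[of "{i}" id] finite_less_\<kappa>[of "{i}"] by auto

text \<open>\<open>ev\<close> is ``modulo the ideal of bounded subsets of \<open>\<kappa>\<close>''.\<close>

definition ev :: "('k \<Rightarrow> bool) \<Rightarrow> bool" where
  "ev P \<longleftrightarrow> (\<exists>z<\<kappa>. \<forall>i. z \<le> i \<longrightarrow> i < \<kappa> \<longrightarrow> P i)"

lemma ev_mono: "ev P \<Longrightarrow> (\<And>i. i < \<kappa> \<Longrightarrow> P i \<Longrightarrow> Q i) \<Longrightarrow> ev Q"
  unfolding ev_def by blast

text \<open>Fewer than \<open>\<kappa>\<close> thresholds have a common bound, by regularity of
  \<open>\<kappa>\<close>.\<close>

lemma ev_ball:
  assumes "|J| <o |{..<\<kappa>}|" "\<And>j. j \<in> J \<Longrightarrow> ev (P j)"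
  shows "ev (\<lambda>i. \<forall>j\<in>J. P j i)"
proof -
  have "\<forall>j\<in>J. \<exists>z. z < \<kappa> \<and> (\<forall>i. z \<le> i \<longrightarrow> i < \<kappa> \<longrightarrow> P j i)" using assms(2) unfolding ev_def by blast
  then obtain z where z: "\<And>j. j \<in> J \<Longrightarrow> z j < \<kappa>" "\<And>j i. j \<in> J \<Longrightarrow> z j \<le> i \<Longrightarrow> i < \<kappa> \<Longrightarrow> P j i"
    by metis
  obtain x where "x < \<kappa>" "\<forall>j\<in>J. z j < x" using \<kappa>_bound[of J z] assms(1) z(1) by blast
  then show ?thesis unfolding ev_def using z(2) by (meson less_imp_le order.trans)
qed

lemma ev_conj:
  assumes "ev P" "ev Q" shows "ev (\<lambda>i. P i \<and> Q i)"
proof -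
  obtain a b where "a < \<kappa>" "b < \<kappa>" "\<And>i. a \<le> i \<Longrightarrow> i < \<kappa> \<Longrightarrow> P i" "\<And>i. b \<le> i \<Longrightarrow> i < \<kappa> \<Longrightarrow> Q i"
    using assms unfolding ev_def by blast
  then show ?thesis unfolding ev_def by (intro exI[of _ "max a b"]) auto
qed

lemma ev_ge: "z < \<kappa> \<Longrightarrow> ev (\<lambda>i. z \<le> i)"
  unfolding ev_def by auto

lemma ev_all: "(\<And>i. i < \<kappa> \<Longrightarrow> P i) \<Longrightarrow> ev P"
  unfolding ev_def using \<kappa>_infinite by (metis finite.emptyI ex_in_conv lessThan_iff)

lemma T_gt: "x < \<mu> \<Longrightarrow> ev (\<lambda>i. x < T i)"
proof -
  assume x: "x < \<mu>"
  obtain y where y: "y < \<mu>" "x < y" using \<mu>_limit_card[OF x] less_of_card_less by blast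
  obtain i where i: "i < \<kappa>" "y \<le> t i" using t_cofinal[OF y(1)] by blast
  have "x < T j" if "i \<le> j" "j < \<kappa>" for j
    using t_le_T[OF that(2,1)] i(2) y(2) by simp
  then show ?thesis unfolding ev_def using i(1) by blast
qed

section \<open>A product of regular cardinals below the singular cardinal\<close>

text \<open>The successor cardinal of \<open>|{..<T i}|\<close>. It is regular and, as
  \<open>T\<close> climbs to \<open>\<mu>\<close>, eventually exceeds any given bound below
  \<open>\<mu>\<close>.\<close>

definition M :: "'k \<Rightarrow> 'k" where "M i = (SOME y. y < \<mu> \<and> succ_card (T i) y)"

lemma M_props: "i < \<kappa> \<Longrightarrow> M i < \<mu> \<and> succ_card (T i) (M i)"
  unfolding M_def by (rule someI_ex) (use succ_below_\<mu> T_less T_infinite in blast)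

lemma M_less: "i < \<kappa> \<Longrightarrow> M i < \<mu>" using M_props by blast

lemma M_cf: "i < \<kappa> \<Longrightarrow> cf_gt {..<T i} (M i)" using M_props succ_card_cf_gt by blast

text \<open>Enumerate \<open>G\<close> along \<open>\<mu>\<close> and at coordinate \<open>i\<close>
  bound only the members with index below \<open>T i\<close>, which the cofinality of
  \<open>M i\<close> permits. Each member is included from some coordinate on.\<close>

lemma directed:
  fixes G :: "('k \<Rightarrow> 'k) set"
  assumes "|G| \<le>o |{..<\<mu>}|" and G: "\<And>g. g \<in> G \<Longrightarrow> ev (\<lambda>i. g i < M i)"
  shows "\<exists>h. (\<forall>i<\<kappa>. h i < M i) \<and> (\<forall>g\<in>G. ev (\<lambda>i. g i < h i))"
proof -
  obtain \<phi> where \<phi>: "G \<subseteq> \<phi> ` {..<\<mu>}"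
    using card_of_ordLeq2[of G "{..<\<mu>}"] assms(1) by (cases "G = {}") auto
  have "\<exists>y. y < M i \<and> (\<forall>x\<in>{x\<in>{..<T i}. \<phi> x i < M i}. \<phi> x i < y)" if "i < \<kappa>" for i
  proof (rule cf_gtD[OF M_cf[OF that]])
    show "|{x\<in>{..<T i}. \<phi> x i < M i}| \<le>o |{..<T i}|" by (intro card_of_mono1) auto
  qed auto
  then have "\<forall>i. \<exists>y. i < \<kappa> \<longrightarrow> y < M i \<and> (\<forall>x<T i. \<phi> x i < M i \<longrightarrow> \<phi> x i < y)"
    by (simp add: Ball_def imp_conjL)
  then obtain h where "\<forall>i. i < \<kappa> \<longrightarrow> h i < M i \<and> (\<forall>x<T i. \<phi> x i < M i \<longrightarrow> \<phi> x i < h i)"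
    by (rule choice[THEN exE])
  then have h: "\<And>i. i < \<kappa> \<Longrightarrow> h i < M i"
      "\<And>i x. i < \<kappa> \<Longrightarrow> x < T i \<Longrightarrow> \<phi> x i < M i \<Longrightarrow> \<phi> x i < h i" by auto
  have "ev (\<lambda>i. g i < h i)" if g: "g \<in> G" for g
  proof -
    obtain x where x: "x < \<mu>" "g = \<phi> x" using \<phi> g by auto
    show ?thesis using ev_conj[OF T_gt[OF x(1)] G[OF g]]
      by (rule ev_mono) (use h(2) x(2) in auto)
  qed
  then show ?thesis using h(1) by blast
qed

section \<open>The recursive construction of the increasing sequence\<close>

text \<open>A club of least cardinality, fixed in advance for each \<open>\<delta>\<close>: the
  existence of any club of size below \<open>\<mu>\<close> makes this one small too.\<close>

definition E :: "'k \<Rightarrow> 'k set" where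
  "E \<delta> = (SOME E. club \<delta> E \<and> (\<forall>E'. club \<delta> E' \<longrightarrow> |E| \<le>o |E'| ))"

lemma E_props:
  assumes "club \<delta> E'"
  shows "club \<delta> (E \<delta>)" "|E \<delta>| \<le>o |E'|"
proof -
  have "\<exists>r\<in>card_of ` {E. club \<delta> E}. \<forall>r'\<in>card_of ` {E. club \<delta> E}. r \<le>o r'"
    using assms card_of_Card_order by (intro exists_minim_Card_order) auto
  then have "\<exists>E. club \<delta> E \<and> (\<forall>E'. club \<delta> E' \<longrightarrow> |E| \<le>o |E'| )" by auto
  from someI_ex[OF this] show "club \<delta> (E \<delta>)" "|E \<delta>| \<le>o |E'|"
    using assms unfolding E_def by auto
qed

definition supf :: "('k \<Rightarrow> 'k \<Rightarrow> 'k) \<Rightarrow> 'k set \<Rightarrow> 'k \<Rightarrow> 'k" where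
  "supf f A i = (LEAST x. \<forall>\<beta>\<in>A. f \<beta> i \<le> x)"

text \<open>The demand on stage \<open>\<alpha>\<close> of the recursion; it is void from
  \<open>\<Lambda>\<close> on, so the recursion is total. The guard
  \<open>E \<alpha> \<subseteq> {..<\<alpha>}\<close> makes it depend on earlier values only, even
  where \<open>E \<alpha>\<close> is an arbitrary set.\<close>

definition next_fun :: "('k \<Rightarrow> 'k \<Rightarrow> 'k) \<Rightarrow> 'k \<Rightarrow> ('k \<Rightarrow> 'k) \<Rightarrow> bool" where
  "next_fun f \<alpha> r \<longleftrightarrow> (\<alpha> < \<Lambda> \<longrightarrow> (\<forall>i<\<kappa>. r i < M i) \<and> (\<forall>\<beta><\<alpha>. ev (\<lambda>i. f \<beta> i < r i)) \<and>
     (E \<alpha> \<subseteq> {..<\<alpha>} \<longrightarrow> (\<exists>z<\<mu>. |E \<alpha>| \<le>o |{..<z}| ) \<longrightarrow> ev (\<lambda>i. supf f (E \<alpha>) i < r i)))"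

lemma next_fun_cong:
  assumes "\<And>y. y < x \<Longrightarrow> f y = g y"
  shows "next_fun f x r = next_fun g x r"
proof -
  have "supf f (E x) = supf g (E x)" if "E x \<subseteq> {..<x}"
    unfolding supf_def using that assms by (auto simp: subset_iff)
  then show ?thesis unfolding next_fun_def using assms by (auto simp: fun_eq_iff)
qed

text \<open>The supremum over a set of size below \<open>\<mu>\<close> is below \<open>M i\<close>
  once \<open>T i\<close> is past that size, so \<open>directed\<close> applies to it together with
  the earlier functions.\<close>

lemma next_fun_exists:
  assumes IH: "\<And>y. y < \<alpha> \<Longrightarrow> next_fun f y (f y)"
  shows "\<exists>r. next_fun f \<alpha> r"
proof (cases "\<alpha> < \<Lambda>")
  case True
  have fM: "f \<beta> i < M i" if "\<beta> < \<alpha>" "i < \<kappa>" for \<beta> i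
    using IH[OF that(1)] that True unfolding next_fun_def by auto
  define c where "c \<longleftrightarrow> E \<alpha> \<subseteq> {..<\<alpha>} \<and> (\<exists>z<\<mu>. |E \<alpha>| \<le>o |{..<z}| )"
  \<comment> \<open>When the club clause is void, the constant least element serves as a harmless
    extra function.\<close>
  define g where "g = (if c then supf f (E \<alpha>) else (\<lambda>i. LEAST x. True))"
  have g: "ev (\<lambda>i. g i < M i)"
  proof (cases c)
    case True
    then obtain z where z: "E \<alpha> \<subseteq> {..<\<alpha>}" "z < \<mu>" "|E \<alpha>| \<le>o |{..<z}|" unfolding c_def by blast
    show ?thesis using T_gt[OF z(2)]
    proof (rule ev_mono)
      fix i assume i: "i < \<kappa>" "z < T i"
      have "|E \<alpha>| \<le>o |{..<T i}|"
        using z(3) card_of_lessThan_mono[OF less_imp_le[OF i(2)]] by (rule ordLeq_transitive)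
      then obtain x where x: "x < M i" "\<forall>\<beta>\<in>E \<alpha>. f \<beta> i < x"
        using cf_gtD[OF M_cf[OF i(1)], of "E \<alpha>" "\<lambda>\<beta>. f \<beta> i"] fM[OF _ i(1)] z(1) by blast
      have "supf f (E \<alpha>) i \<le> x" unfolding supf_def using x(2) by (intro Least_le) (auto simp: less_imp_le)
      then show "g i < M i" using x(1) True by (simp add: g_def)
    qed
  next
    case False
    show ?thesis
    proof (rule ev_all)
      fix i assume "i < \<kappa>"
      then obtain x where "x < M i" using cf_gtD[OF M_cf, of i "{}" id] by (auto simp: card_of_empty)
      then show "g i < M i" using False by (auto simp: g_def intro: le_less_trans[OF Least_le])
    qed
  qed
  have "|f ` {..<\<alpha>}| \<le>o |{..<\<mu>}|"
    using card_of_image True \<Lambda>_succ ordLeq_transitive unfolding succ_card_def by blast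
  then have "|insert g (f ` {..<\<alpha>})| \<le>o |{..<\<mu>}|" by (rule card_of_insert_ordLeq[OF \<mu>_infinite])
  then obtain h where "(\<forall>i<\<kappa>. h i < M i) \<and> (\<forall>g\<in>insert g (f ` {..<\<alpha>}). ev (\<lambda>i. g i < h i))"
    by (rule exE[OF directed]) (use g fM ev_all in auto)
  then have "next_fun f \<alpha> h" unfolding next_fun_def g_def c_def by (auto split: if_splits)
  then show ?thesis by blast
qed (simp add: next_fun_def)

definition F :: "'k \<Rightarrow> 'k \<Rightarrow> 'k" where
  "F = (SOME f. \<forall>\<alpha>. next_fun f \<alpha> (f \<alpha>))"

lemma next_fun_F: "next_fun F \<alpha> (F \<alpha>)"
proof -
  have "\<exists>f. \<forall>\<alpha>. next_fun f \<alpha> (f \<alpha>)"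
    using dependent_wellorder_choice[of next_fun] next_fun_cong next_fun_exists by blast
  then have "\<forall>\<alpha>. next_fun F \<alpha> (F \<alpha>)" unfolding F_def by (rule someI_ex)
  then show ?thesis by blast
qed

lemma F_less: "\<alpha> < \<Lambda> \<Longrightarrow> i < \<kappa> \<Longrightarrow> F \<alpha> i < M i"
  using next_fun_F[of \<alpha>] unfolding next_fun_def by blast

lemma F_mono: "\<beta> < \<alpha> \<Longrightarrow> \<alpha> < \<Lambda> \<Longrightarrow> ev (\<lambda>i. F \<beta> i < F \<alpha> i)"
  using next_fun_F[of \<alpha>] unfolding next_fun_def by blast

lemma F_sup: "\<alpha> < \<Lambda> \<Longrightarrow> club \<alpha> (E \<alpha>) \<Longrightarrow> z < \<mu> \<Longrightarrow> |E \<alpha>| \<le>o |{..<z}| \<Longrightarrow> ev (\<lambda>i. supf F (E \<alpha>) i < F \<alpha> i)"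
  using next_fun_F[of \<alpha>] unfolding next_fun_def club_def by blast

lemma supf_upper:
  assumes "A \<subseteq> {..<\<Lambda>}" "i < \<kappa>"
  shows "\<beta> \<in> A \<Longrightarrow> F \<beta> i \<le> supf F A i"
proof -
  have "\<forall>\<beta>\<in>A. F \<beta> i \<le> M i" using F_less assms by (auto simp: less_imp_le subset_iff)
  then have "\<forall>\<beta>\<in>A. F \<beta> i \<le> supf F A i" unfolding supf_def by (rule LeastI)
  then show "\<beta> \<in> A \<Longrightarrow> F \<beta> i \<le> supf F A i" by blast
qed

lemma supf_mono:
  assumes "B \<subseteq> A" "A \<subseteq> {..<\<Lambda>}" "i < \<kappa>"
  shows "supf F B i \<le> supf F A i"
  unfolding supf_def[of F B] using supf_upper[OF assms(2,3)] assms(1) by (intro Least_le) auto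


section \<open>Strongly increasing subsequences\<close>

text \<open>Along a continuous sequence \<open>\<xi>\<close> of length \<open>\<sigma>\<close> with limit \<open>\<delta>\<close>, the point \<open>n i\<close> of \<open>X\<close> after
  \<open>\<xi> i\<close> is chosen so that \<open>F (n i)\<close> dominates each of the \<open>\<sigma>\<close> many candidate suprema that any
  \<open>F \<gamma>\<close> dominates.  A guess inside the club where \<open>\<xi>\<close> meets \<open>E \<delta>\<close> is dominated by \<open>F \<delta>\<close>.\<close>

lemma strongly_increasing_subset:
  assumes \<theta>: "\<theta> < \<mu>" "\<kappa> \<le> \<theta>"
    and X: "X \<subseteq> {..<\<Lambda>}" "\<And>x. x < \<Lambda> \<Longrightarrow> \<exists>y\<in>X. x < y"
  shows "\<exists>X0\<subseteq>X. |{..<\<theta>}| <o |X0| \<and>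
    (\<exists>z<\<kappa>. \<forall>\<alpha>\<in>X0. \<forall>\<beta>\<in>X0. \<alpha> < \<beta> \<longrightarrow> (\<forall>j. z \<le> j \<longrightarrow> j < \<kappa> \<longrightarrow> F \<alpha> j < F \<beta> j))"
proof -
  have \<theta>inf: "infinite {..<\<theta>}"
    using \<kappa>_infinite \<theta>(2) by (metis finite_subset lessThan_subset_iff)
  \<comment> \<open>Club guessing is used on three successive cardinal successors above
    \<open>\<theta>\<close>, all still below \<open>\<mu>\<close>.\<close>
  obtain \<chi> where \<chi>: "\<chi> < \<mu>" "succ_card \<theta> \<chi>" using succ_below_\<mu>[OF \<theta>(1) \<theta>inf] by blast
  obtain \<rho> where \<rho>: "\<rho> < \<mu>" "succ_card \<chi> \<rho>"
    using succ_below_\<mu>[OF \<chi>(1) succ_card_infinite[OF \<chi>(2)]] by blast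
  obtain \<sigma> where \<sigma>: "\<sigma> < \<mu>" "succ_card \<rho> \<sigma>"
    using succ_below_\<mu>[OF \<rho>(1) succ_card_infinite[OF \<rho>(2)]] by blast
  have \<rho>inf: "infinite {..<\<rho>}" using \<sigma>(2) by (simp add: succ_card_def)
  have cf\<sigma>: "cf_gt {..<\<rho>} \<sigma>" using \<sigma>(2) by (rule succ_card_cf_gt)
  have \<sigma>lim: "\<exists>k<\<sigma>. j < k" if "j < \<sigma>" for j using cf_gt_limit[OF cf\<sigma> \<rho>inf that] .
  have \<sigma>\<mu>: "|{..<i}| \<le>o |{..<\<mu>}|" if "i \<le> \<sigma>" for i using that \<sigma>(1) by (intro card_of_lessThan_mono) auto
  define e :: 'k where "e = (LEAST x. True)"
  have e: "e \<le> x" for x unfolding e_def by (rule Least_le) simp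
  obtain C where C: "\<And>D. club \<sigma> D \<Longrightarrow> e \<in> D \<Longrightarrow> \<exists>\<alpha><\<sigma>. C \<alpha> \<subseteq> D \<and> |{..<\<theta>}| <o |C \<alpha>|"
    using club_guessing[OF \<chi>(2) \<rho>(2) \<sigma>(2) e] by meson
  \<comment> \<open>The supremum over the images of the part of the guess \<open>C \<alpha>\<close>
    up to \<open>i\<close>. The point \<open>e\<close> is left out: it will be put into the club
    artificially, and \<open>\<xi> e\<close> need not lie in \<open>E \<delta>\<close>.\<close>
  define h where "h \<xi> \<alpha> i = supf F (\<xi> ` ((C \<alpha> - {e}) \<inter> {..i}))" for \<xi> :: "'k \<Rightarrow> 'k" and \<alpha> i
  define nxp where "nxp \<xi> i x \<longleftrightarrow> x \<in> X \<and> \<xi> i < x \<and>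
    (\<forall>\<alpha><\<sigma>. (\<exists>\<gamma><\<Lambda>. ev (\<lambda>j. h \<xi> \<alpha> i j < F \<gamma> j)) \<longrightarrow> ev (\<lambda>j. h \<xi> \<alpha> i j < F x j))" for \<xi> i x
  define nx where "nx \<xi> i = (SOME x. nxp \<xi> i x)" for \<xi> i
  have nx_cong: "nx f j = nx g j" if "j < x" "\<And>y. y < x \<Longrightarrow> f y = g y" for f g j x
  proof -
    have "f ` ((C \<alpha> - {e}) \<inter> {..j}) = g ` ((C \<alpha> - {e}) \<inter> {..j})" for \<alpha>
      using that by (intro image_cong) auto
    then show ?thesis using that unfolding nx_def nxp_def h_def by simp
  qed
  \<comment> \<open>\<open>\<xi> i\<close> is the least strict upper bound of the earlier choices,
    which makes \<open>\<xi>\<close> continuous; by \<open>nx_cong\<close> those choices use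
    \<open>\<xi>\<close> below \<open>i\<close> only.\<close>
  have "\<exists>\<xi>. \<forall>i. \<xi> i = (LEAST r. \<forall>j<i. nx \<xi> j < r)"
  proof (rule dependent_wellorder_choice[where P = "\<lambda>\<xi> i r. r = (LEAST r. \<forall>j<i. nx \<xi> j < r)"])
    fix r and f g :: "'k \<Rightarrow> 'k" and x assume "\<And>y. y < x \<Longrightarrow> f y = g y"
    then have "\<forall>j<x. nx f j = nx g j" using nx_cong by blast
    then show "(r = (LEAST r. \<forall>j<x. nx f j < r)) = (r = (LEAST r. \<forall>j<x. nx g j < r))" by simp
  qed simp
  then obtain \<xi> where \<xi>: "\<And>i. \<xi> i = (LEAST r. \<forall>j<i. nx \<xi> j < r)" by meson
  define n where "n = nx \<xi>"
  have n_spec: "nxp \<xi> i (n i)" if \<xi>i: "\<xi> i < \<Lambda>" for i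
  proof -
    define \<gamma> where "\<gamma> \<alpha> = (SOME \<gamma>. \<gamma> < \<Lambda> \<and> ev (\<lambda>j. h \<xi> \<alpha> i j < F \<gamma> j))" for \<alpha>
    define J where "J = {\<alpha>. \<alpha> < \<sigma> \<and> (\<exists>\<gamma><\<Lambda>. ev (\<lambda>j. h \<xi> \<alpha> i j < F \<gamma> j))}"
    have \<gamma>: "\<gamma> \<alpha> < \<Lambda> \<and> ev (\<lambda>j. h \<xi> \<alpha> i j < F (\<gamma> \<alpha>) j)" if "\<alpha> \<in> J" for \<alpha>
      unfolding \<gamma>_def by (rule someI_ex) (use that J_def in blast)
    have "|J| \<le>o |{..<\<mu>}|"
      using card_of_mono1[of J "{..<\<sigma>}"] \<sigma>\<mu>[of \<sigma>] ordLeq_transitive by (auto simp: J_def)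
    then obtain y where y: "y < \<Lambda>" "\<forall>\<alpha>\<in>J. \<gamma> \<alpha> < y"
      using cf_gtD[OF \<Lambda>_cf, of J \<gamma>] \<gamma> by blast
    obtain x where x: "x \<in> X" "max y (\<xi> i) < x" using X(2)[of "max y (\<xi> i)"] y(1) \<xi>i by auto
    have "ev (\<lambda>j. h \<xi> \<alpha> i j < F x j)" if "\<alpha> \<in> J" for \<alpha>
    proof -
      have "\<gamma> \<alpha> < x" "x < \<Lambda>" using y(2) that x X(1) by (auto intro: less_trans)
      from ev_conj[OF F_mono[OF this] conjunct2[OF \<gamma>[OF that]]]
      show ?thesis by (rule ev_mono) auto
    qed
    then have "nxp \<xi> i x" using x unfolding nxp_def J_def by auto
    then show ?thesis unfolding n_def nx_def by (rule someI)
  qed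
  have \<xi>_props: "i \<le> \<sigma> \<Longrightarrow> \<xi> i < \<Lambda> \<and> (\<forall>j<i. n j < \<xi> i)" for i
  proof (induction i rule: less_induct)
    case (less i)
    have "n j < \<Lambda>" if "j < i" for j
      using less.IH[OF that] n_spec[of j] that less.prems X(1) unfolding nxp_def by auto
    then obtain r where r: "r < \<Lambda>" "\<forall>j\<in>{..<i}. n j < r"
      using cf_gtD[OF \<Lambda>_cf \<sigma>\<mu>[OF less.prems], of n] by auto
    have P: "\<forall>j<i. nx \<xi> j < r" using r(2) by (simp add: n_def)
    have "\<xi> i \<le> r" using Least_le[of "\<lambda>r. \<forall>j<i. nx \<xi> j < r" r] P unfolding \<xi>[of i] by blast
    moreover have "\<forall>j<i. n j < \<xi> i"
      using LeastI[of "\<lambda>r. \<forall>j<i. nx \<xi> j < r" r] P unfolding \<xi>[of i] n_def by blast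
    ultimately show ?case using r(1) by auto
  qed
  have \<xi>_less: "\<xi> i < \<Lambda>" if "i \<le> \<sigma>" for i using \<xi>_props that by blast
  have n_less: "n j < \<xi> i" if "j < i" "i \<le> \<sigma>" for i j using \<xi>_props that by blast
  have \<xi>_n: "\<exists>j<i. y \<le> n j" if y: "y < \<xi> i" for i y
    using not_less_Least[of y "\<lambda>r. \<forall>j<i. nx \<xi> j < r"] y unfolding \<xi>[of i] n_def by (auto simp: not_less)
  have np: "n i \<in> X" "\<xi> i < n i" if "i \<le> \<sigma>" for i using n_spec[OF \<xi>_less[OF that]] by (auto simp: nxp_def)
  have \<xi>_mono: "\<xi> j < \<xi> i" if "j < i" "i \<le> \<sigma>" for i j
    using less_trans[OF np(2)[of j] n_less[OF that]] that by simp
  have n_mono: "n j < n i" if "j < i" "i \<le> \<sigma>" for i j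
    using n_less[OF that] np(2)[OF that(2)] by auto
  have \<xi>_mono': "\<xi> j < \<xi> i" and n_less': "n j < \<xi> i" if "j < i" "i < \<sigma>" for i j
    using \<xi>_mono n_less that by auto
  define \<delta> where "\<delta> = \<xi> \<sigma>"
  have \<delta>: "\<delta> < \<Lambda>" unfolding \<delta>_def by (rule \<xi>_less) simp
  \<comment> \<open>Its size is at most \<open>|{..<\<sigma>}|\<close>, so \<open>E \<delta>\<close>
    is small and \<open>F \<delta>\<close> obeys the club clause.\<close>
  have "club \<delta> (\<xi> ` {..<\<sigma>})"
    unfolding club_def
  proof (intro conjI allI impI)
    show "\<xi> ` {..<\<sigma>} \<subseteq> {..<\<delta>}" using \<xi>_mono by (auto simp: \<delta>_def)
  next
    fix x assume "x < \<delta>"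
    then obtain j where j: "j < \<sigma>" "x \<le> n j" using \<xi>_n unfolding \<delta>_def by blast
    obtain k where k: "k < \<sigma>" "j < k" using \<sigma>lim[OF j(1)] by blast
    then have "x < \<xi> k" using n_less'[of j k] j(2) by (meson le_less_trans)
    then show "\<exists>d\<in>\<xi> ` {..<\<sigma>}. x < d" using k(1) by blast
  next
    fix x assume x: "x < \<delta>" "lim_pt (\<xi> ` {..<\<sigma>}) x"
    define i where "i = (LEAST i. x \<le> \<xi> i)"
    have i: "x \<le> \<xi> i" "i \<le> \<sigma>" unfolding i_def
      by (rule LeastI[of _ \<sigma>], use x in \<open>simp add: \<delta>_def\<close>) (rule Least_le, use x in \<open>simp add: \<delta>_def\<close>)
    have below: "\<xi> j < x" if "j < i" for j
      using not_less_Least[OF that[unfolded i_def]] by simp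
    have "x = \<xi> i"
    proof (rule ccontr)
      assume "x \<noteq> \<xi> i"
      then have "x < \<xi> i" using i(1) by simp
      then obtain j where j: "j < i" "x \<le> n j" using \<xi>_n by blast
      obtain k where k: "k < \<sigma>" "\<xi> j < \<xi> k" "\<xi> k < x" using x(2) below[OF j(1)] unfolding lim_pt_def by blast
      have "j < k" using k(2) \<xi>_mono'[of k j] j(1) i(2) by (metis linorder_neqE less_asym less_le_trans)
      then have "n j < \<xi> k" using n_less'[of j k] k(1) by simp
      then show False using j(2) k(3) by simp
    qed
    moreover have "i \<noteq> \<sigma>" using calculation x(1) by (auto simp: \<delta>_def)
    ultimately show "x \<in> \<xi> ` {..<\<sigma>}" using i(2) by auto
  qed
  from E_props[OF this] have E: "club \<delta> (E \<delta>)" "|E \<delta>| \<le>o |\<xi> ` {..<\<sigma>}|" by auto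
  have "|E \<delta>| \<le>o |{..<\<sigma>}|" using E(2) card_of_image ordLeq_transitive by blast
  then have Esup: "ev (\<lambda>i. supf F (E \<delta>) i < F \<delta> i)" using F_sup[OF \<delta> E(1) \<sigma>(1)] by blast
  have E\<delta>: "E \<delta> \<subseteq> {..<\<delta>}" and Ecl: "\<And>x. x < \<delta> \<Longrightarrow> lim_pt (E \<delta>) x \<Longrightarrow> x \<in> E \<delta>"
    and Eunb: "\<And>x. x < \<delta> \<Longrightarrow> \<exists>d\<in>E \<delta>. x < d" using E(1) unfolding club_def by blast+
  have E\<Lambda>: "E \<delta> \<subseteq> {..<\<Lambda>}" using E\<delta> \<delta> by auto
  \<comment> \<open>The pullback of \<open>E \<delta>\<close> along \<open>\<xi>\<close>, with the
    least point \<open>e\<close> added because the guessing statement asks for it.\<close>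
  define D where "D = insert e {i. i < \<sigma> \<and> \<xi> i \<in> E \<delta>}"
  have e\<sigma>: "e < \<sigma>" using \<sigma>(2) e by (metis le_less_trans less_of_card_less succ_card_def)
  have "club \<sigma> D"
    unfolding club_def
  proof (intro conjI allI impI)
    show "D \<subseteq> {..<\<sigma>}" using e\<sigma> by (auto simp: D_def)
  next
    fix i0 assume i0: "i0 < \<sigma>"
    have "\<exists>k<\<sigma>. \<exists>d\<in>E \<delta>. \<xi> j < d \<and> d < \<xi> k" if j: "j < \<sigma>" for j
    proof -
      obtain d where d: "d \<in> E \<delta>" "\<xi> j < d" using Eunb[of "\<xi> j"] \<xi>_mono[of j \<sigma>] j by (auto simp: \<delta>_def)
      then obtain k' where k': "k' < \<sigma>" "d \<le> n k'" using \<xi>_n[of d \<sigma>] E\<delta> by (auto simp: \<delta>_def)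
      obtain k where k: "k < \<sigma>" "k' < k" using \<sigma>lim[OF k'(1)] by blast
      then show ?thesis using d k'(2) n_less'[of k' k] by (meson le_less_trans less_imp_le)
    qed
    \<comment> \<open>Between \<open>\<xi> j\<close> and \<open>\<xi> (\<nu> j)\<close> there is a
      point of \<open>E \<delta>\<close>; at a limit \<open>i\<close> closed under
      \<open>\<nu>\<close>, \<open>\<xi> i\<close> is therefore a limit of
      \<open>E \<delta>\<close>.\<close>
    then obtain \<nu> where \<nu>: "\<And>j. j < \<sigma> \<Longrightarrow> \<nu> j < \<sigma>" "\<And>j. j < \<sigma> \<Longrightarrow> \<exists>d\<in>E \<delta>. \<xi> j < d \<and> d < \<xi> (\<nu> j)"
      by metis
    have bd: "\<exists>x<\<sigma>. \<forall>j\<le>\<beta>. \<nu> j < x" if b: "\<beta> < \<sigma>" for \<beta>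
    proof -
      have "|{..\<beta>}| \<le>o |{..<\<rho>}|" using \<sigma>(2) b unfolding succ_card_def by (auto intro: card_of_atMost_ordLeq)
      from cf_gtD[OF cf\<sigma> this, of \<nu>] show ?thesis using \<nu>(1) b by auto
    qed
    obtain i where i: "i < \<sigma>" "i0 < i" "\<forall>j<i. \<nu> j < i" "\<forall>j<i. \<exists>k<i. j < k"
      using closure_point_exists[OF cf_gt_mono[OF cf\<sigma> card_of_nat_ordLeq[OF \<rho>inf]] bd i0] by blast
    have "lim_pt (E \<delta>) (\<xi> i)"
      unfolding lim_pt_def
    proof (intro conjI allI impI)
      show "\<exists>y. y < \<xi> i" using \<xi>_mono'[OF i(2,1)] by blast
    next
      fix y assume "y < \<xi> i"
      then obtain j where j: "j < i" "y \<le> n j" using \<xi>_n by blast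
      obtain k where k: "k < i" "j < k" using i(4) j(1) by blast
      have "y < \<xi> k" using le_less_trans[OF j(2) n_less'[of j k]] k i(1) by simp
      moreover obtain d where "d \<in> E \<delta>" "\<xi> k < d" "d < \<xi> (\<nu> k)" using \<nu>(2)[OF less_trans[OF k(1) i(1)]] by blast
      moreover have "\<xi> (\<nu> k) < \<xi> i" using \<xi>_mono'[of "\<nu> k" i] i(1,3) k(1) by auto
      ultimately show "\<exists>d\<in>E \<delta>. y < d \<and> d < \<xi> i" by (meson less_trans)
    qed
    then have "\<xi> i \<in> E \<delta>" using Ecl[of "\<xi> i"] \<xi>_mono[of i \<sigma>] i(1) by (auto simp: \<delta>_def)
    then show "\<exists>d\<in>D. i0 < d" using i(1,2) by (auto simp: D_def)
  next
    fix x assume x: "x < \<sigma>" "lim_pt D x"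
    have "lim_pt (E \<delta>) (\<xi> x)"
      unfolding lim_pt_def
    proof (intro conjI allI impI)
      show "\<exists>y. y < \<xi> x" using x \<xi>_mono' unfolding lim_pt_def by blast
    next
      fix y assume "y < \<xi> x"
      then obtain j where j: "j < x" "y \<le> n j" using \<xi>_n by blast
      obtain d where d: "d \<in> D" "j < d" "d < x" using x(2) j(1) unfolding lim_pt_def by blast
      have "\<xi> d \<in> E \<delta>" using d(1,2) e[of j] by (auto simp: D_def)
      moreover have "y < \<xi> d" using le_less_trans[OF j(2) n_less'[of j d]] d x(1) by simp
      moreover have "\<xi> d < \<xi> x" using \<xi>_mono'[OF d(3) x(1)] .
      ultimately show "\<exists>d\<in>E \<delta>. y < d \<and> d < \<xi> x" by blast
    qed
    then have "\<xi> x \<in> E \<delta>" using Ecl[of "\<xi> x"] \<xi>_mono[of x \<sigma>] x(1) by (auto simp: \<delta>_def)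
    then show "x \<in> D" using x(1) by (simp add: D_def)
  qed
  then obtain \<alpha> where \<alpha>: "\<alpha> < \<sigma>" "C \<alpha> \<subseteq> D" "|{..<\<theta>}| <o |C \<alpha>|" using C[of D] by (auto simp: D_def)
  define Q where "Q = C \<alpha> - {e}"
  have QE: "\<xi> i \<in> E \<delta>" and Q\<sigma>: "i < \<sigma>" if "i \<in> Q" for i using \<alpha>(2) that by (auto simp: Q_def D_def)
  have Qbig: "|{..<\<theta>}| <o |Q|"
  proof (rule ccontr)
    assume "\<not> ?thesis"
    then have "|Q| \<le>o |{..<\<theta>}|" by (simp add: not_ordLess_iff_ordLeq card_of_Well_order)
    then have "|insert e Q| \<le>o |{..<\<theta>}|" by (rule card_of_insert_ordLeq[OF \<theta>inf])
    moreover have "|C \<alpha>| \<le>o |insert e Q|" unfolding Q_def by (intro card_of_mono1) auto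
    ultimately show False using \<alpha>(3) not_ordLess_ordLeq ordLeq_transitive by blast
  qed
  define H where "H i = h \<xi> \<alpha> i" for i
  have HQ: "H i = supf F (\<xi> ` (Q \<inter> {..i}))" for i by (simp add: H_def h_def Q_def)
  have subE: "\<xi> ` (Q \<inter> {..i}) \<subseteq> E \<delta>" for i using QE by auto
  have Hn: "ev (\<lambda>j. H i j < F (n i) j)" if "i \<in> Q" for i
  proof -
    \<comment> \<open>\<open>H i\<close> is a supremum over part of \<open>E \<delta>\<close>. Hence
      \<open>\<delta>\<close> itself is a witness in the condition under which \<open>n i\<close>
      was chosen to dominate \<open>H i\<close>.\<close>
    have "ev (\<lambda>j. H i j < F \<delta> j)"
      using Esup by (rule ev_mono) (use supf_mono[OF subE E\<Lambda>] HQ in \<open>auto intro: le_less_trans\<close>)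
    then show ?thesis 
      using n_spec[OF \<xi>_less[OF less_imp_le[OF Q\<sigma>[OF that]]]] \<alpha>(1) \<delta> unfolding nxp_def H_def by blast
  qed
  define nxt where "nxt i = (LEAST k. k \<in> Q \<and> i < k)" for i
  have nxt: "nxt i \<in> Q" "i < nxt i" "nxt i \<le> k" if "i < k" "k \<in> Q" for i k
    using LeastI[of "\<lambda>k. k \<in> Q \<and> i < k" k] Least_le[of "\<lambda>k. k \<in> Q \<and> i < k" k] that by (auto simp: nxt_def)
  \<comment> \<open>One threshold handles both comparisons; the guard covers an \<open>i\<close>
    without a successor in \<open>Q\<close>.\<close>
  have "\<exists>z. z < \<kappa> \<and> (\<forall>j. z \<le> j \<longrightarrow> j < \<kappa> \<longrightarrow> H i j < F (n i) j \<and> (nxt i \<in> Q \<and> i < nxt i \<longrightarrow> F (n i) j < F (\<xi> (nxt i)) j))"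
    if i: "i \<in> Q" for i
  proof -
    have "ev (\<lambda>j. nxt i \<in> Q \<and> i < nxt i \<longrightarrow> F (n i) j < F (\<xi> (nxt i)) j)"
    proof (cases "nxt i \<in> Q \<and> i < nxt i")
      case True
      then have "ev (\<lambda>j. F (n i) j < F (\<xi> (nxt i)) j)"
        using Q\<sigma>[of "nxt i"] \<xi>_less[of "nxt i"] n_less'[of i "nxt i"] by (intro F_mono) (simp_all add: less_imp_le)
      then show ?thesis by (rule ev_mono) simp
    qed (auto intro: ev_all)
    from ev_conj[OF Hn[OF i] this] show ?thesis unfolding ev_def by blast
  qed
  then obtain z where zz: "\<And>i. i \<in> Q \<Longrightarrow> z i < \<kappa>"
    "\<And>i j. i \<in> Q \<Longrightarrow> z i \<le> j \<Longrightarrow> j < \<kappa> \<Longrightarrow> H i j < F (n i) j \<and> (nxt i \<in> Q \<and> i < nxt i \<longrightarrow> F (n i) j < F (\<xi> (nxt i)) j)"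
    by metis
  \<comment> \<open>More than \<open>|{..<\<theta>}|\<close> points share a threshold, because
    \<open>\<kappa>\<close> is at most \<open>\<theta>\<close>.\<close>
  obtain z0 where z0: "z0 < \<kappa>" "|{..<\<theta>}| <o |{i\<in>Q. z i = z0}|"
    using pigeonhole_card[OF \<theta>inf Qbig card_of_lessThan_mono[OF \<theta>(2)], of z] zz(1) by auto
  define X0 where "X0 = n ` {i\<in>Q. z i = z0}"
  have inj: "inj_on n {i\<in>Q. z i = z0}"
    using n_mono Q\<sigma> by (intro inj_onI) (metis (mono_tags, lifting) less_imp_le less_irrefl linorder_neqE mem_Collect_eq)
  then have "|{i\<in>Q. z i = z0}| \<le>o |X0|" using card_of_ordLeq unfolding X0_def by blast
  then have "|{..<\<theta>}| <o |X0|" using z0(2) ordLess_ordLeq_trans by blast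
  moreover have "X0 \<subseteq> X" using np(1) Q\<sigma> by (auto simp: X0_def less_imp_le)
  moreover have "F a j < F b j" if ab: "a \<in> X0" "b \<in> X0" "a < b" and j: "z0 \<le> j" "j < \<kappa>" for a b j
  proof -
    obtain i l where il: "a = n i" "b = n l" "i \<in> Q" "l \<in> Q" "z i = z0" "z l = z0"
      using ab(1,2) by (auto simp: X0_def)
    have "i < l" using ab(3) il n_mono[of l i] Q\<sigma>[of i] by (metis less_asym less_imp_le less_irrefl linorder_neqE)
    note nx = nxt[OF this il(4)]
    \<comment> \<open>Since \<open>nxt i\<close> is in \<open>Q\<close> and at most
      \<open>l\<close>, the function at \<open>\<xi> (nxt i)\<close> enters the supremum
      \<open>H l\<close>, which \<open>F (n l)\<close> dominates from the same threshold on.\<close>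
    have "F a j < F (\<xi> (nxt i)) j" using zz(2)[OF il(3), of j] il(1,5) j nx by auto
    also have "\<dots> \<le> H l j" unfolding HQ
      using nx subE[of l] E\<Lambda> by (intro supf_upper) (use j(2) in auto)
    also have "\<dots> < F b j" using zz(2)[OF il(4), of j] il(2,6) j by auto
    finally show ?thesis .
  qed
  ultimately show ?thesis using z0(1) by (intro exI[of _ X0]) blast
qed

end

section \<open>A scale below a singular cardinal\<close>

context singular
begin

section \<open>The exact least upper bound of the sequence\<close>

lemma ev_frequently: "\<not> ev P \<Longrightarrow> ev Q \<Longrightarrow> \<exists>i<\<kappa>. Q i \<and> \<not> P i"
  using ev_mono[of Q P] by blast

lemma \<Lambda>_limit: "\<alpha> < \<Lambda> \<Longrightarrow> \<exists>\<beta><\<Lambda>. \<alpha> < \<beta>"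
  by (rule cf_gt_limit[OF \<Lambda>_cf \<mu>_infinite])

text \<open>The projection of \<open>g\<close> upwards into the sets \<open>S i\<close>; membership
  of \<open>M i\<close> in \<open>S i\<close> makes it well defined for every
  \<open>F \<alpha>\<close>.\<close>

definition proj :: "('k \<Rightarrow> 'k set) \<Rightarrow> ('k \<Rightarrow> 'k) \<Rightarrow> 'k \<Rightarrow> 'k" where
  "proj S g i = (LEAST s. s \<in> S i \<and> g i \<le> s)"

lemma proj_le: "s \<in> S i \<Longrightarrow> g i \<le> s \<Longrightarrow> proj S g i \<le> s"
  unfolding proj_def by (rule Least_le) simp

lemma
  assumes "M i \<in> S i" "\<alpha> < \<Lambda>" "i < \<kappa>"
  shows proj_mem: "proj S (F \<alpha>) i \<in> S i" and proj_ge: "F \<alpha> i \<le> proj S (F \<alpha>) i"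
proof -
  have "proj S (F \<alpha>) i \<in> S i \<and> F \<alpha> i \<le> proj S (F \<alpha>) i"
    unfolding proj_def by (rule LeastI[of _ "M i"]) (use assms F_less in \<open>auto intro: less_imp_le\<close>)
  then show "proj S (F \<alpha>) i \<in> S i" "F \<alpha> i \<le> proj S (F \<alpha>) i" by auto
qed

definition ub :: "('k \<Rightarrow> 'k) \<Rightarrow> bool" where
  "ub u \<longleftrightarrow> (\<forall>\<alpha><\<Lambda>. ev (\<lambda>i. F \<alpha> i \<le> u i))"

text \<open>If every projection fails to bound the sequence, thin out to indices at which each later
  function escapes each earlier projection. On a strongly increasing subset, fix by pigeonhole a
  coordinate \<open>j\<close> where many escapes happen; the projections at \<open>j\<close> then
  increase strictly more often than the size of \<open>S j\<close> allows.\<close>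

lemma bounding_projection:
  assumes \<theta>: "\<theta> < \<mu>" "\<kappa> \<le> \<theta>"
    and S: "\<And>i. i < \<kappa> \<Longrightarrow> |S i| \<le>o |{..<\<theta>}|" "\<And>i. i < \<kappa> \<Longrightarrow> M i \<in> S i"
  shows "\<exists>\<xi><\<Lambda>. ub (proj S (F \<xi>))"
proof (rule ccontr)
  assume no: "\<not> ?thesis"
  have \<theta>inf: "infinite {..<\<theta>}"
    using \<kappa>_infinite \<theta>(2) by (metis finite_subset lessThan_subset_iff)
  have "\<forall>\<xi>. \<exists>\<alpha>. \<xi> < \<Lambda> \<longrightarrow> \<alpha> < \<Lambda> \<and> \<not> ev (\<lambda>i. F \<alpha> i \<le> proj S (F \<xi>) i)"
    using no unfolding ub_def by blast
  then obtain \<nu> where "\<forall>\<xi>. \<xi> < \<Lambda> \<longrightarrow> \<nu> \<xi> < \<Lambda> \<and> \<not> ev (\<lambda>i. F (\<nu> \<xi>) i \<le> proj S (F \<xi>) i)"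
    by (rule choice[THEN exE])
  then have \<nu>: "\<And>\<xi>. \<xi> < \<Lambda> \<Longrightarrow> \<nu> \<xi> < \<Lambda>" "\<And>\<xi>. \<xi> < \<Lambda> \<Longrightarrow> \<not> ev (\<lambda>i. F (\<nu> \<xi>) i \<le> proj S (F \<xi>) i)"
    by auto
  define X where "X = {\<beta>. \<beta> < \<Lambda> \<and> (\<forall>\<alpha><\<beta>. \<nu> \<alpha> < \<beta>)}"
  have X: "\<exists>y\<in>X. x < y" if x: "x < \<Lambda>" for x
  proof -
    have bd: "\<exists>x<\<Lambda>. \<forall>j\<le>\<beta>. \<nu> j < x" if b: "\<beta> < \<Lambda>" for \<beta>
    proof -
      have "|{..\<beta>}| \<le>o |{..<\<mu>}|"
        using \<Lambda>_succ b unfolding succ_card_def by (auto intro: card_of_atMost_ordLeq)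
      from cf_gtD[OF \<Lambda>_cf this, of \<nu>] show ?thesis using \<nu>(1) b by auto
    qed
    show ?thesis
      using closure_point_exists[OF cf_gt_mono[OF \<Lambda>_cf card_of_nat_ordLeq[OF \<mu>_infinite]] bd x]
      unfolding X_def by blast
  qed
  have sep: "\<not> ev (\<lambda>i. F \<beta> i \<le> proj S (F \<alpha>) i)" if "\<alpha> < \<beta>" "\<beta> \<in> X" for \<alpha> \<beta>
  proof
    assume ev: "ev (\<lambda>i. F \<beta> i \<le> proj S (F \<alpha>) i)"
    have \<beta>: "\<beta> < \<Lambda>" "\<nu> \<alpha> < \<beta>" "\<alpha> < \<Lambda>" using that by (auto simp: X_def)
    have "ev (\<lambda>i. F (\<nu> \<alpha>) i \<le> proj S (F \<alpha>) i)"
      using ev_conj[OF F_mono[OF \<beta>(2,1)] ev] by (rule ev_mono) auto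
    then show False using \<nu>(2)[OF \<beta>(3)] by blast
  qed
  have "X \<subseteq> {..<\<Lambda>}" by (auto simp: X_def)
  from strongly_increasing_subset[OF \<theta> this X]
  obtain X0 z where X0: "X0 \<subseteq> X" "|{..<\<theta>}| <o |X0|" and z: "z < \<kappa>"
    and inc: "\<And>\<alpha> \<beta> j. \<alpha> \<in> X0 \<Longrightarrow> \<beta> \<in> X0 \<Longrightarrow> \<alpha> < \<beta> \<Longrightarrow> z \<le> j \<Longrightarrow> j < \<kappa> \<Longrightarrow> F \<alpha> j < F \<beta> j"
    by blast
  \<comment> \<open>Only a possible last element of \<open>X0\<close> is dropped, so that
    \<open>nxt\<close> is meaningful.\<close>
  define X1 where "X1 = {\<alpha>\<in>X0. \<exists>\<beta>\<in>X0. \<alpha> < \<beta>}"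
  have X1: "|{..<\<theta>}| <o |X1|"
  proof (rule ccontr)
    assume "\<not> ?thesis"
    then have le: "|X1| \<le>o |{..<\<theta>}|" by (simp add: not_ordLess_iff_ordLeq card_of_Well_order)
    have "\<exists>m. X0 \<subseteq> insert m X1"
    proof (cases "X0 \<subseteq> X1")
      case False
      then obtain m where "m \<in> X0" "m \<notin> X1" by blast
      then have "X0 \<subseteq> insert m X1" unfolding X1_def by (auto simp: not_less) (metis le_neq_trans)
      then show ?thesis by blast
    qed blast
    then obtain m where "X0 \<subseteq> insert m X1" by blast
    then have "|X0| \<le>o |{..<\<theta>}|"
      using card_of_mono1 card_of_insert_ordLeq[OF \<theta>inf le] ordLeq_transitive by blast
    then show False using X0(2) not_ordLess_ordLeq by blast
  qed
  define nxt where "nxt \<alpha> = (LEAST \<beta>. \<beta> \<in> X0 \<and> \<alpha> < \<beta>)" for \<alpha>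
  have nxt: "nxt \<alpha> \<in> X0" "\<alpha> < nxt \<alpha>" "nxt \<alpha> \<le> \<beta>" if "\<alpha> < \<beta>" "\<beta> \<in> X0" for \<alpha> \<beta>
    using LeastI[of "\<lambda>k. k \<in> X0 \<and> \<alpha> < k" \<beta>] Least_le[of "\<lambda>k. k \<in> X0 \<and> \<alpha> < k" \<beta>] that by (auto simp: nxt_def)
  have "\<forall>\<alpha>. \<exists>j. \<alpha> \<in> X1 \<longrightarrow> z \<le> j \<and> j < \<kappa> \<and> proj S (F \<alpha>) j < F (nxt \<alpha>) j"
  proof (intro allI)
    fix \<alpha>
    show "\<exists>j. \<alpha> \<in> X1 \<longrightarrow> z \<le> j \<and> j < \<kappa> \<and> proj S (F \<alpha>) j < F (nxt \<alpha>) j"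
    proof (cases "\<alpha> \<in> X1")
      case True
      then obtain \<beta> where "\<alpha> < \<beta>" "\<beta> \<in> X0" unfolding X1_def by blast
      from nxt[OF this] have "\<not> ev (\<lambda>i. F (nxt \<alpha>) i \<le> proj S (F \<alpha>) i)" using sep X0(1) by blast
      from ev_frequently[OF this ev_ge[OF z]] show ?thesis by (auto simp: not_le)
    qed blast
  qed
  then obtain jf where "\<forall>\<alpha>. \<alpha> \<in> X1 \<longrightarrow> z \<le> jf \<alpha> \<and> jf \<alpha> < \<kappa> \<and> proj S (F \<alpha>) (jf \<alpha>) < F (nxt \<alpha>) (jf \<alpha>)"
    by (rule choice[THEN exE])
  then have jf: "z \<le> jf \<alpha>" "jf \<alpha> < \<kappa>" "proj S (F \<alpha>) (jf \<alpha>) < F (nxt \<alpha>) (jf \<alpha>)" if "\<alpha> \<in> X1" for \<alpha>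
    using that by auto
  obtain j where j: "j < \<kappa>" "|{..<\<theta>}| <o |{\<alpha>\<in>X1. jf \<alpha> = j}|"
    using pigeonhole_card[OF \<theta>inf X1 card_of_lessThan_mono[OF \<theta>(2)], of jf] jf(2) by auto
  define Y where "Y = {\<alpha>\<in>X1. jf \<alpha> = j}"
  have Y\<Lambda>: "\<alpha> \<in> X0" "\<alpha> < \<Lambda>" if "\<alpha> \<in> Y" for \<alpha> using that X0(1) by (auto simp: Y_def X1_def X_def)
  have step: "proj S (F \<alpha>) j < proj S (F \<beta>) j" if "\<alpha> \<in> Y" "\<beta> \<in> Y" "\<alpha> < \<beta>" for \<alpha> \<beta>
  proof -
    note nx = nxt[OF that(3) Y\<Lambda>(1)[OF that(2)]]
    have zj: "z \<le> j" "proj S (F \<alpha>) j < F (nxt \<alpha>) j" using jf[of \<alpha>] that(1) by (auto simp: Y_def)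
    note zj(2)
    \<comment> \<open>\<open>nxt \<alpha>\<close> is at most \<open>\<beta>\<close>, and the
      functions indexed by \<open>X0\<close> increase at every coordinate from \<open>z\<close> on,
      in particular at \<open>j\<close>.\<close>
    also have "F (nxt \<alpha>) j \<le> F \<beta> j"
      using inc[OF nx(1) Y\<Lambda>(1)[OF that(2)] _ zj(1) j(1)] nx(3) by (cases "nxt \<alpha> = \<beta>") (auto intro: less_imp_le)
    also have "F \<beta> j \<le> proj S (F \<beta>) j" using S(2)[OF j(1)] Y\<Lambda>(2)[OF that(2)] j(1) by (rule proj_ge)
    finally show ?thesis .
  qed
  have "inj_on (\<lambda>\<alpha>. proj S (F \<alpha>) j) Y"
    by (intro inj_onI) (metis step less_irrefl linorder_neqE)
  moreover have "(\<lambda>\<alpha>. proj S (F \<alpha>) j) ` Y \<subseteq> S j" using proj_mem[of j S] S(2) j(1) Y\<Lambda>(2) by auto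
  ultimately have "|Y| \<le>o |S j|" using card_of_ordLeq by blast
  then have "|Y| \<le>o |{..<\<theta>}|" using S(1)[OF j(1)] ordLeq_transitive by blast
  then show False using j(2) not_ordLess_ordLeq unfolding Y_def by blast
qed

text \<open>Otherwise build \<open>\<pi>\<close> many upper bounds, where \<open>\<pi>\<close> is
  the successor of \<open>\<kappa>\<close>: some projection into the earlier values is an upper
  bound, and since it is not least, a new bound \<open>u \<nu>\<close> fails to lie above it.
  Projections of a single \<open>F \<zeta>\<close> into the growing sets move down, so all
  coordinates stabilise at a common stage, and the bound added there contradicts its own
  choice.\<close>

lemma lub_exists:
  "\<exists>h. (\<forall>i<\<kappa>. h i \<le> M i) \<and> ub h \<and> (\<forall>u. ub u \<longrightarrow> ev (\<lambda>i. h i \<le> u i))"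
proof (rule ccontr)
  assume no: "\<not> ?thesis"
  obtain \<pi> where \<pi>: "\<pi> < \<mu>" "succ_card \<kappa> \<pi>" using succ_below_\<mu>[OF \<kappa>_less \<kappa>_infinite] by blast
  have \<pi>cf: "cf_gt {..<\<kappa>} \<pi>" using \<pi>(2) by (rule succ_card_cf_gt)
  define S where "S u \<nu> i = insert (M i) ((\<lambda>\<eta>. u \<eta> i) ` {..<\<nu>})" for u :: "'k \<Rightarrow> 'k \<Rightarrow> 'k" and \<nu> i
  define P where "P u \<nu> r \<longleftrightarrow> (\<nu> < \<pi> \<longrightarrow> ub r \<and> (\<exists>\<xi><\<Lambda>. \<not> ev (\<lambda>i. proj (S u \<nu>) (F \<xi>) i \<le> r i)))" for u \<nu> r
  have "\<exists>u. \<forall>\<nu>. P u \<nu> (u \<nu>)"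
  proof (rule dependent_wellorder_choice)
    fix r and f g :: "'k \<Rightarrow> 'k \<Rightarrow> 'k" and x assume "\<And>y. y < x \<Longrightarrow> f y = g y"
    then have "S f x = S g x" by (intro ext) (auto simp: S_def)
    then show "P f x r = P g x r" unfolding P_def by simp
  next
    fix x and f :: "'k \<Rightarrow> 'k \<Rightarrow> 'k"
    show "\<exists>r. P f x r"
    proof (cases "x < \<pi>")
      case True
      have "|S f x i| \<le>o |{..<\<kappa>}|" for i
      proof -
        have "|(\<lambda>\<eta>. f \<eta> i) ` {..<x}| \<le>o |{..<\<kappa>}|"
          using card_of_image \<pi>(2) True ordLeq_transitive unfolding succ_card_def by blast
        then show ?thesis unfolding S_def by (rule card_of_insert_ordLeq[OF \<kappa>_infinite])
      qed
      then obtain \<xi> where \<xi>: "\<xi> < \<Lambda>" "ub (proj (S f x) (F \<xi>))"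
        using bounding_projection[OF \<kappa>_less order_refl, of "S f x"] by (auto simp: S_def)
      \<comment> \<open>This puts the projection among the candidates for \<open>h\<close> that the
        negated claim speaks of.\<close>
      have "\<forall>i<\<kappa>. proj (S f x) (F \<xi>) i \<le> M i"
        using F_less[OF \<xi>(1)] by (auto intro!: proj_le simp: S_def less_imp_le)
      then obtain r where "ub r" "\<not> ev (\<lambda>i. proj (S f x) (F \<xi>) i \<le> r i)" using no \<xi>(2) by blast
      then show ?thesis using \<xi>(1) unfolding P_def by blast
    qed (simp add: P_def)
  qed
  then obtain u where u: "\<And>\<nu>. P u \<nu> (u \<nu>)" by blast
  have "\<forall>\<nu>. \<exists>\<xi>. \<nu> < \<pi> \<longrightarrow> \<xi> < \<Lambda> \<and> \<not> ev (\<lambda>i. proj (S u \<nu>) (F \<xi>) i \<le> u \<nu> i)"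
    using u unfolding P_def by blast
  then obtain \<xi> where "\<forall>\<nu>. \<nu> < \<pi> \<longrightarrow> \<xi> \<nu> < \<Lambda> \<and> \<not> ev (\<lambda>i. proj (S u \<nu>) (F (\<xi> \<nu>)) i \<le> u \<nu> i)"
    by (rule choice[THEN exE])
  then have \<xi>: "\<xi> \<nu> < \<Lambda>" "\<not> ev (\<lambda>i. proj (S u \<nu>) (F (\<xi> \<nu>)) i \<le> u \<nu> i)" if "\<nu> < \<pi>" for \<nu>
    using that by auto
  \<comment> \<open>One index beyond all the witnesses \<open>\<xi> \<nu>\<close>, so that
    \<open>F \<zeta>\<close> can replace each of them.\<close>
  obtain \<zeta> where \<zeta>: "\<zeta> < \<Lambda>" "\<forall>\<nu>\<in>{..<\<pi>}. \<xi> \<nu> < \<zeta>"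
    using cf_gtD[OF \<Lambda>_cf card_le_\<mu>[OF less_imp_le[OF \<pi>(1)]], of \<xi>] \<xi>(1) by blast
  define q where "q \<nu> = proj (S u \<nu>) (F \<zeta>)" for \<nu>
  have qm: "q \<nu> i \<in> S u \<nu> i" and qg: "F \<zeta> i \<le> q \<nu> i" if "i < \<kappa>" for \<nu> i
  proof -
    have "M i \<in> S u \<nu> i" by (simp add: S_def)
    then show "q \<nu> i \<in> S u \<nu> i" "F \<zeta> i \<le> q \<nu> i"
      unfolding q_def using \<zeta>(1) that by (auto intro: proj_mem proj_ge)
  qed
  have q_anti: "q y i \<le> q x i" if "x \<le> y" "i < \<kappa>" for x y i
  proof -
    have "S u x i \<subseteq> S u y i" using that(1) by (auto simp: S_def intro: less_le_trans)
    then show ?thesis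
      using qm[OF that(2), of x] qg[OF that(2), of x] unfolding q_def[of y] by (intro proj_le) auto
  qed
  have "\<exists>z. z < \<pi>" using cf_gtD[OF \<pi>cf card_of_empty, of id] by blast
  then have "\<exists>x<\<pi>. \<forall>y. x \<le> y \<longrightarrow> y < \<pi> \<longrightarrow> q y i = q x i" if "i < \<kappa>" for i
    using antimono_stabilises[of \<pi> "\<lambda>\<nu>. q \<nu> i"] q_anti that by blast
  then have "\<forall>i. \<exists>x. i < \<kappa> \<longrightarrow> x < \<pi> \<and> (\<forall>y. x \<le> y \<longrightarrow> y < \<pi> \<longrightarrow> q y i = q x i)" by blast
  then obtain st where "\<forall>i. i < \<kappa> \<longrightarrow> st i < \<pi> \<and> (\<forall>y. st i \<le> y \<longrightarrow> y < \<pi> \<longrightarrow> q y i = q (st i) i)"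
    by (rule choice[THEN exE])
  then have st: "st i < \<pi>" "\<And>y. st i \<le> y \<Longrightarrow> y < \<pi> \<Longrightarrow> q y i = q (st i) i" if "i < \<kappa>" for i
    using that by blast+
  obtain x where x: "x < \<pi>" "\<forall>i\<in>{..<\<kappa>}. st i < x"
    using cf_gtD[OF \<pi>cf ordIso_imp_ordLeq[OF card_of_refl], of st] st(1) by blast
  obtain y where y: "y < \<pi>" "x < y" using cf_gt_limit[OF \<pi>cf \<kappa>_infinite x(1)] by blast
  have "ub (u x)" using u[of x] x(1) unfolding P_def by blast
  then have "ev (\<lambda>i. F \<zeta> i \<le> u x i)" using \<zeta>(1) unfolding ub_def by blast
  moreover have "ev (\<lambda>i. F (\<xi> x) i < F \<zeta> i)" using \<zeta> x(1) by (intro F_mono) auto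
  ultimately have "ev (\<lambda>i. F \<zeta> i \<le> u x i \<and> F (\<xi> x) i < F \<zeta> i)" by (rule ev_conj)
  then have "ev (\<lambda>i. proj (S u x) (F (\<xi> x)) i \<le> u x i)"
  proof (rule ev_mono)
    fix i assume i: "i < \<kappa>" and le: "F \<zeta> i \<le> u x i \<and> F (\<xi> x) i < F \<zeta> i"
    have "proj (S u x) (F (\<xi> x)) i \<le> q x i"
      using qm[OF i, of x] qg[OF i, of x] le by (intro proj_le) auto
    \<comment> \<open>By stage \<open>y\<close> the value \<open>u x i\<close> has joined the
      projection set, so stability forces \<open>q x i\<close> below it.\<close>
    also have "q x i = q y i" using st(2)[OF i] x y i by (metis lessThan_iff less_imp_le less_trans)
    also have "q y i \<le> u x i" unfolding q_def using le y(2) by (intro proj_le) (auto simp: S_def)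
    finally show "proj (S u x) (F (\<xi> x)) i \<le> u x i" .
  qed
  then show False using \<xi>(2)[OF x(1)] by blast
qed

text \<open>Project into \<open>{g i, h i, M i}\<close>. Some projection bounds the sequence and so
  is eventually at least \<open>h\<close>; were \<open>F \<xi> i \<le> g i\<close> there, the
  projection would be at most \<open>g i\<close>, below \<open>h i\<close>.\<close>

lemma exact_lub:
  assumes h: "\<And>u. ub u \<Longrightarrow> ev (\<lambda>i. h i \<le> u i)" and g: "ev (\<lambda>i. g i < h i)"
  shows "\<exists>\<xi><\<Lambda>. ev (\<lambda>i. g i < F \<xi> i)"
proof -
  define S where "S i = {g i, h i, M i}" for i
  have "|S i| \<le>o |{..<\<kappa>}|" for i
    unfolding S_def by (intro ordLess_imp_ordLeq finite_less_\<kappa>) simp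
  then obtain \<xi> where \<xi>: "\<xi> < \<Lambda>" "ub (proj S (F \<xi>))"
    using bounding_projection[OF \<kappa>_less order_refl, of S] by (auto simp: S_def)
  have "ev (\<lambda>i. g i < F \<xi> i)" using ev_conj[OF g h[OF \<xi>(2)]]
  proof (rule ev_mono)
    fix i assume i: "g i < h i \<and> h i \<le> proj S (F \<xi>) i"
    show "g i < F \<xi> i"
    proof (rule ccontr)
      assume "\<not> g i < F \<xi> i"
      then have "proj S (F \<xi>) i \<le> g i" by (intro proj_le) (auto simp: S_def)
      then show False using i by auto
    qed
  qed
  then show ?thesis using \<xi>(1) by blast
qed

lemma below_ub:
  assumes "ub h" "\<alpha> < \<Lambda>"
  shows "ev (\<lambda>i. F \<alpha> i < h i)"
proof -
  obtain \<beta> where \<beta>: "\<beta> < \<Lambda>" "\<alpha> < \<beta>" using \<Lambda>_limit[OF assms(2)] by blast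
  then have "ev (\<lambda>i. F \<beta> i \<le> h i)" using assms(1) unfolding ub_def by blast
  from ev_conj[OF this F_mono[OF \<beta>(2,1)]] show ?thesis by (rule ev_mono) auto
qed

text \<open>If the cofinality bound fails at unboundedly many \<open>i\<close>, put small cofinal
  subsets of these \<open>h i\<close> into the projection sets. The bounding projection then falls
  below \<open>h i\<close> at such an \<open>i\<close>, against minimality of
  \<open>h\<close>.\<close>

lemma cf_lub:
  assumes ubh: "ub h" and h: "\<And>u. ub u \<Longrightarrow> ev (\<lambda>i. h i \<le> u i)" and \<tau>: "\<tau> < \<mu>"
  shows "ev (\<lambda>i. cf_gt {..<\<tau>} (h i))"
proof (rule ccontr)
  assume no: "\<not> ?thesis"
  define \<theta> where "\<theta> = max \<tau> \<kappa>"
  have \<theta>: "\<theta> < \<mu>" "\<kappa> \<le> \<theta>" using \<tau> \<kappa>_less by (auto simp: \<theta>_def)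
  have \<theta>inf: "infinite {..<\<theta>}"
    using \<kappa>_infinite \<theta>(2) by (metis finite_subset lessThan_subset_iff)
  have "\<forall>i. \<exists>B. \<not> cf_gt {..<\<tau>} (h i) \<longrightarrow> B \<subseteq> {..<h i} \<and> |B| \<le>o |{..<\<tau>}| \<and> (\<forall>x<h i. \<exists>b\<in>B. x \<le> b)"
    unfolding cf_gt_def by (simp only: not_all not_imp not_ex not_less) (meson not_less)
  then obtain B where "\<forall>i. \<not> cf_gt {..<\<tau>} (h i) \<longrightarrow> B i \<subseteq> {..<h i} \<and> |B i| \<le>o |{..<\<tau>}| \<and> (\<forall>x<h i. \<exists>b\<in>B i. x \<le> b)"
    by (rule choice[THEN exE])
  then have B: "B i \<subseteq> {..<h i}" "|B i| \<le>o |{..<\<tau>}|" "\<And>x. x < h i \<Longrightarrow> \<exists>b\<in>B i. x \<le> b"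
    if "\<not> cf_gt {..<\<tau>} (h i)" for i using that by auto
  define S where "S i = insert (M i) (if cf_gt {..<\<tau>} (h i) then {} else B i)" for i
  have "|S i| \<le>o |{..<\<theta>}|" for i
  proof -
    have "|B i| \<le>o |{..<\<theta>}|" if "\<not> cf_gt {..<\<tau>} (h i)"
      using B(2)[OF that] card_of_lessThan_mono[of \<tau> \<theta>] ordLeq_transitive unfolding \<theta>_def by (meson max.cobounded1)
    then show ?thesis unfolding S_def by (intro card_of_insert_ordLeq[OF \<theta>inf]) (auto simp: card_of_empty)
  qed
  then obtain \<xi> where \<xi>: "\<xi> < \<Lambda>" "ub (proj S (F \<xi>))"
    using bounding_projection[OF \<theta>, of S] by (auto simp: S_def)
  obtain i where i: "i < \<kappa>" "F \<xi> i < h i" "h i \<le> proj S (F \<xi>) i" "\<not> cf_gt {..<\<tau>} (h i)"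
    using ev_frequently[OF no ev_conj[OF below_ub[OF ubh \<xi>(1)] h[OF \<xi>(2)]]] by blast
  obtain b where b: "b \<in> B i" "F \<xi> i \<le> b" using B(3)[OF i(4,2)] by blast
  then have "proj S (F \<xi>) i \<le> b" using i(4) by (intro proj_le) (auto simp: S_def)
  moreover have "b < h i" using B(1)[OF i(4)] b(1) by auto
  ultimately show False using i(3) by auto
qed


section \<open>Scales on a thinned set of coordinates\<close>

text \<open>\<open>I\<close> stands in for \<open>\<kappa>\<close>. The ordinals \<open>h j\<close>
  need not be regular cardinals; instead the cofinality of each one exceeds the size of every
  earlier one.\<close>

definition is_scale :: "'k set \<Rightarrow> ('k \<Rightarrow> 'k) \<Rightarrow> ('k \<Rightarrow> 'k \<Rightarrow> 'k) \<Rightarrow> bool" where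
  "is_scale I h f \<longleftrightarrow> I \<subseteq> {..<\<kappa>} \<and> (\<forall>x<\<kappa>. \<exists>i\<in>I. x < i) \<and>
     (\<forall>j\<in>I. h j < \<mu> \<and> cf_gt {..<\<kappa>} (h j)) \<and> (\<forall>i\<in>I. \<forall>j\<in>I. i < j \<longrightarrow> cf_gt {..<h i} (h j)) \<and>
     (\<forall>\<alpha><\<Lambda>. \<forall>j\<in>I. f \<alpha> j < h j) \<and>
     (\<forall>\<alpha> \<beta>. \<alpha> < \<beta> \<longrightarrow> \<beta> < \<Lambda> \<longrightarrow> ev (\<lambda>j. j \<in> I \<longrightarrow> f \<alpha> j < f \<beta> j)) \<and>
     (\<forall>g. (\<forall>j\<in>I. g j < h j) \<longrightarrow> (\<exists>\<alpha><\<Lambda>. ev (\<lambda>j. j \<in> I \<longrightarrow> g j < f \<alpha> j)))"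

lemma scale_exists: "\<exists>I h f. is_scale I h f"
proof -
  obtain h where hM: "\<And>i. i < \<kappa> \<Longrightarrow> h i \<le> M i" and ubh: "ub h"
    and hl: "\<And>u. ub u \<Longrightarrow> ev (\<lambda>i. h i \<le> u i)" using lub_exists by blast
  obtain z0 where z0: "z0 < \<kappa>" "\<And>j. z0 \<le> j \<Longrightarrow> j < \<kappa> \<Longrightarrow> cf_gt {..<\<kappa>} (h j)"
    using cf_lub[OF ubh hl \<kappa>_less] unfolding ev_def by blast
  have "\<forall>i. \<exists>z. i < \<kappa> \<longrightarrow> z < \<kappa> \<and> (\<forall>j. z \<le> j \<longrightarrow> j < \<kappa> \<longrightarrow> cf_gt {..<M i} (h j))"
    using cf_lub[OF ubh hl M_less] unfolding ev_def by blast
  then obtain s where "\<forall>i. i < \<kappa> \<longrightarrow> s i < \<kappa> \<and> (\<forall>j. s i \<le> j \<longrightarrow> j < \<kappa> \<longrightarrow> cf_gt {..<M i} (h j))"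
    by (rule choice[THEN exE])
  then have s: "s i < \<kappa>" "\<And>j. s i \<le> j \<Longrightarrow> j < \<kappa> \<Longrightarrow> cf_gt {..<M i} (h j)" if "i < \<kappa>" for i
    using that by blast+
  have "\<exists>In. \<forall>j. In j \<longleftrightarrow> (j < \<kappa> \<and> z0 \<le> j \<and> (\<forall>i<j. In i \<longrightarrow> s i \<le> j))"
    by (rule dependent_wellorder_choice[where P = "\<lambda>In j r. r \<longleftrightarrow> (j < \<kappa> \<and> z0 \<le> j \<and> (\<forall>i<j. In i \<longrightarrow> s i \<le> j))"])
      auto
  then obtain In where In: "\<And>j. In j \<longleftrightarrow> (j < \<kappa> \<and> z0 \<le> j \<and> (\<forall>i<j. In i \<longrightarrow> s i \<le> j))" by blast
  define I where "I = {j. In j}"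
  have I: "j < \<kappa>" "z0 \<le> j" "\<And>i. i < j \<Longrightarrow> i \<in> I \<Longrightarrow> s i \<le> j" if "j \<in> I" for j
    using that In[of j] unfolding I_def by auto
  have Iunb: "\<exists>i\<in>I. x < i" if x: "x < \<kappa>" for x
  proof (rule ccontr)
    assume no: "\<not> ?thesis"
    then have "I \<subseteq> {..x}" by (auto simp: not_less)
    then have "|I| <o |{..<\<kappa>}|" using card_of_mono1 card_atMost_\<kappa>[OF x] ordLeq_ordLess_trans by blast
    then obtain b where b: "b < \<kappa>" "\<forall>i\<in>I. s i < b" using \<kappa>_bound[of I s] s(1) I(1) by blast
    obtain j where j: "j < \<kappa>" "max x (max b z0) < j" using \<kappa>_limit[of "max x (max b z0)"] x b(1) z0(1) by auto
    then have xj: "x < j" "b < j" "z0 < j" by auto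
    have "s i \<le> j" if "In i" for i
    proof -
      have "s i < b" using b(2) that unfolding I_def by blast
      then show ?thesis using xj(2) by auto
    qed
    then have "In j" using j(1) xj(3) by (subst In) auto
    then show False using no xj(1) unfolding I_def by blast
  qed
  define e :: 'k where "e = (LEAST x. True)"
  have e: "e \<le> x" for x unfolding e_def by (rule Least_le) simp
  have eh: "e < h j" if "z0 \<le> j" "j < \<kappa>" for j
    using cf_gtD[OF z0(2)[OF that] card_of_empty, of id] e le_less_trans by blast
  \<comment> \<open>\<open>F \<alpha>\<close> is below \<open>h\<close> only modulo a bounded set;
    the finitely or otherwise boundedly placed exceptions get the least value \<open>e\<close>,
    which changes nothing modulo \<open>ev\<close>.\<close>
  define f where "f \<alpha> j = (if F \<alpha> j < h j then F \<alpha> j else e)" for \<alpha> j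
  have fF: "ev (\<lambda>j. f \<alpha> j = F \<alpha> j)" if "\<alpha> < \<Lambda>" for \<alpha>
    using below_ub[OF ubh that] by (rule ev_mono) (simp add: f_def)
  have 1: "h j < \<mu> \<and> cf_gt {..<\<kappa>} (h j)" if "j \<in> I" for j
    using I[OF that] hM[of j] M_less[of j] z0(2) by (auto intro: le_less_trans)
  have 2: "cf_gt {..<h i} (h j)" if "i \<in> I" "j \<in> I" "i < j" for i j
    using s(2)[of i j] I[OF that(1)] I[OF that(2)] that card_of_lessThan_mono[OF hM[of i]]
    by (auto intro: cf_gt_mono)
  have 3: "f \<alpha> j < h j" if "j \<in> I" for \<alpha> j
    using eh[of j] I[OF that] by (simp add: f_def)
  have 4: "ev (\<lambda>j. j \<in> I \<longrightarrow> f \<alpha> j < f \<beta> j)" if "\<alpha> < \<beta>" "\<beta> < \<Lambda>" for \<alpha> \<beta>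
    using ev_conj[OF F_mono[OF that] ev_conj[OF fF[OF less_trans[OF that]] fF[OF that(2)]]]
    by (rule ev_mono) simp
  have 5: "\<exists>\<alpha><\<Lambda>. ev (\<lambda>j. j \<in> I \<longrightarrow> g j < f \<alpha> j)" if g: "\<forall>j\<in>I. g j < h j" for g
  proof -
    have "ev (\<lambda>j. (if j \<in> I then g j else e) < h j)"
      using ev_ge[OF z0(1)] by (rule ev_mono) (use eh g in auto)
    from exact_lub[OF hl this] obtain \<alpha> where \<alpha>: "\<alpha> < \<Lambda>" "ev (\<lambda>j. (if j \<in> I then g j else e) < F \<alpha> j)"
      by blast
    have "ev (\<lambda>j. j \<in> I \<longrightarrow> g j < f \<alpha> j)"
      using ev_conj[OF \<alpha>(2) fF[OF \<alpha>(1)]] by (rule ev_mono) auto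
    then show ?thesis using \<alpha>(1) by blast
  qed
  have "I \<subseteq> {..<\<kappa>}" using I(1) by auto
  then have "is_scale I h f" unfolding is_scale_def using Iunb 1 2 3 4 5 by simp
  then show ?thesis by blast
qed

section \<open>Colourings from a scale\<close>

definition large_family :: "'k set set \<Rightarrow> bool" where
  "large_family A \<longleftrightarrow> (\<forall>a\<in>A. a \<subseteq> {..<\<Lambda>} \<and> |a| <o |{..<\<kappa>}| ) \<and>
     |{..<\<mu>}| <o |A| \<and> pairwise disjnt A \<and> {} \<notin> A"

text \<open>Comparing all pairs expresses that \<open>a\<close> lies entirely below \<open>b\<close>
  also for infinite members, which may lack a maximum.\<close>

definition attains :: "('k \<Rightarrow> 'k \<Rightarrow> 'q) \<Rightarrow> 'k set set \<Rightarrow> 'q \<Rightarrow> bool" where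
  "attains c A q \<longleftrightarrow> (\<exists>a\<in>A. \<exists>b\<in>A. \<forall>\<alpha>\<in>a. \<forall>\<beta>\<in>b. \<alpha> < \<beta> \<and> c \<alpha> \<beta> = q)"

text \<open>The colour \<open>c \<alpha> \<beta>\<close> is the last coordinate of the scale at which the function with
  index \<open>\<alpha>\<close> is not below the one with index \<open>\<beta>\<close>.\<close>

lemma last_coordinate_colouring:
  "\<exists>I c. I \<subseteq> {..<\<kappa>} \<and> (\<forall>x<\<kappa>. \<exists>i\<in>I. x < i) \<and>
     (\<forall>A. large_family A \<longrightarrow> ev (\<lambda>i. i \<in> I \<longrightarrow> attains c A i))"
proof -
  obtain I h f where sc: "is_scale I h f" using scale_exists by blast
  have I: "I \<subseteq> {..<\<kappa>}" "\<forall>x<\<kappa>. \<exists>i\<in>I. x < i"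
    using sc unfolding is_scale_def by blast+
  have h: "\<And>j. j \<in> I \<Longrightarrow> h j < \<mu>" "\<And>j. j \<in> I \<Longrightarrow> cf_gt {..<\<kappa>} (h j)"
      "\<And>i j. i \<in> I \<Longrightarrow> j \<in> I \<Longrightarrow> i < j \<Longrightarrow> cf_gt {..<h i} (h j)"
    using sc unfolding is_scale_def by blast+
  have f: "\<And>\<alpha> j. \<alpha> < \<Lambda> \<Longrightarrow> j \<in> I \<Longrightarrow> f \<alpha> j < h j"
      "\<And>\<alpha> \<beta>. \<alpha> < \<beta> \<Longrightarrow> \<beta> < \<Lambda> \<Longrightarrow> ev (\<lambda>j. j \<in> I \<longrightarrow> f \<alpha> j < f \<beta> j)"
      "\<And>g. \<forall>j\<in>I. g j < h j \<Longrightarrow> \<exists>\<alpha><\<Lambda>. ev (\<lambda>j. j \<in> I \<longrightarrow> g j < f \<alpha> j)"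
    using sc unfolding is_scale_def by simp_all
  define c where "c \<alpha> \<beta> = (LEAST z. z \<in> I \<and> (\<forall>j\<in>I. z < j \<longrightarrow> f \<alpha> j < f \<beta> j))" for \<alpha> \<beta>
  have c_eq: "c \<alpha> \<beta> = i" if "i \<in> I" "\<not> f \<alpha> i < f \<beta> i" "\<And>j. j \<in> I \<Longrightarrow> i < j \<Longrightarrow> f \<alpha> j < f \<beta> j" for \<alpha> \<beta> i
    unfolding c_def by (rule Least_equality) (use that in \<open>auto simp: not_less[symmetric]\<close>)
  have "ev (\<lambda>i. i \<in> I \<longrightarrow> attains c A i)" if lA: "large_family A" for A
  proof -
    have A: "\<forall>a\<in>A. a \<subseteq> {..<\<Lambda>} \<and> |a| <o |{..<\<kappa>}|" "|{..<\<mu>}| <o |A|" "pairwise disjnt A"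
      using lA unfolding large_family_def by blast+
    have A\<Lambda>: "\<alpha> < \<Lambda>" if "a \<in> A" "\<alpha> \<in> a" for a \<alpha> using A(1) that by blast
    \<comment> \<open>Disjoint members that all meet \<open>{..x}\<close> would inject into it, yet
      it has size at most \<open>|{..<\<mu>}|\<close>.\<close>
    have above: "\<exists>b\<in>A. \<forall>\<beta>\<in>b. x < \<beta>" if x: "x < \<Lambda>" for x
    proof (rule ccontr)
      assume "\<not> ?thesis"
      then have "\<forall>b. \<exists>\<beta>. b \<in> A \<longrightarrow> \<beta> \<in> b \<and> \<beta> \<le> x" by (auto simp: not_less)
      then obtain r where "\<forall>b. b \<in> A \<longrightarrow> r b \<in> b \<and> r b \<le> x" by (rule choice[THEN exE])
      then have r: "r b \<in> b" "r b \<le> x" if "b \<in> A" for b using that by auto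
      have "inj_on r A"
        using A(3) r(1) unfolding pairwise_def disjnt_def by (intro inj_onI) (metis disjoint_iff)
      moreover have "r ` A \<subseteq> {..x}" using r(2) by auto
      ultimately have "|A| \<le>o |{..x}|" using card_of_ordLeq by blast
      moreover have "|{..x}| \<le>o |{..<\<mu>}|"
        using \<Lambda>_succ x unfolding succ_card_def by (auto intro: card_of_atMost_ordLeq)
      ultimately show False using A(2) not_ordLess_ordLeq ordLeq_transitive by blast
    qed
    have dom: "\<exists>b\<in>A. (\<forall>\<beta>\<in>b. x < \<beta>) \<and> ev (\<lambda>j. j \<in> I \<longrightarrow> (\<forall>\<beta>\<in>b. g j < f \<beta> j))"
      if g: "\<forall>j\<in>I. g j < h j" and x: "x < \<Lambda>" for g x
    proof -
      obtain \<delta> where \<delta>: "\<delta> < \<Lambda>" "ev (\<lambda>j. j \<in> I \<longrightarrow> g j < f \<delta> j)" using f(3)[OF g] by blast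
      obtain b where b: "b \<in> A" "\<forall>\<beta>\<in>b. max x \<delta> < \<beta>" using above[of "max x \<delta>"] x \<delta>(1) by auto
      have "ev (\<lambda>j. \<forall>\<beta>\<in>b. j \<in> I \<longrightarrow> f \<delta> j < f \<beta> j)"
        using A(1) b by (intro ev_ball f(2)) auto
      from ev_conj[OF \<delta>(2) this] have "ev (\<lambda>j. j \<in> I \<longrightarrow> (\<forall>\<beta>\<in>b. g j < f \<beta> j))"
        by (rule ev_mono) (auto intro: less_trans)
      then show ?thesis using b by auto
    qed
    define hit where "hit i \<gamma> \<longleftrightarrow> (\<exists>a\<in>A. \<forall>\<alpha>\<in>a. \<gamma> < f \<alpha> i)" for i \<gamma>
    have "ev (\<lambda>i. i \<in> I \<longrightarrow> (\<forall>\<gamma><h i. hit i \<gamma>))"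
    proof (rule ccontr)
      assume no: "\<not> ?thesis"
      have "\<forall>i. \<exists>\<gamma>. i \<in> I \<longrightarrow> \<gamma> < h i \<and> ((\<forall>\<gamma><h i. hit i \<gamma>) \<or> \<not> hit i \<gamma>)"
      proof
        fix i
        have "\<exists>\<gamma>. \<gamma> < h i" if "i \<in> I" using cf_gtD[OF h(2)[OF that] card_of_empty, of id] by blast
        then show "\<exists>\<gamma>. i \<in> I \<longrightarrow> \<gamma> < h i \<and> ((\<forall>\<gamma><h i. hit i \<gamma>) \<or> \<not> hit i \<gamma>)" by blast
      qed
      \<comment> \<open>\<open>g\<close> picks a value that is not hit wherever there is one. A
        member whose functions eventually exceed \<open>g\<close> hits it after all.\<close>
      then obtain g where g: "\<forall>i. i \<in> I \<longrightarrow> g i < h i \<and> ((\<forall>\<gamma><h i. hit i \<gamma>) \<or> \<not> hit i (g i))"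
        by (rule choice[THEN exE])
      have gI: "\<forall>j\<in>I. g j < h j" using g by blast
      have "\<exists>x. x < \<Lambda>" using cf_gtD[OF \<Lambda>_cf card_of_empty, of id] by blast
      then obtain a where a: "a \<in> A" "ev (\<lambda>j. j \<in> I \<longrightarrow> (\<forall>\<beta>\<in>a. g j < f \<beta> j))" using dom[OF gI] by blast
      obtain i where i: "i \<in> I" "\<forall>\<beta>\<in>a. g i < f \<beta> i" "\<not> (\<forall>\<gamma><h i. hit i \<gamma>)"
        using ev_frequently[OF no a(2)] by blast
      have "hit i (g i)" unfolding hit_def using a(1) i(2) by blast
      then show False using g i(1,3) by blast
    qed
    then obtain z1 where z1: "z1 < \<kappa>"
      "\<And>i \<gamma>. z1 \<le> i \<Longrightarrow> i \<in> I \<Longrightarrow> \<gamma> < h i \<Longrightarrow> \<exists>a\<in>A. \<forall>\<alpha>\<in>a. \<gamma> < f \<alpha> i"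
      using I(1) unfolding ev_def hit_def by blast
    have "\<forall>i. \<forall>\<gamma>. \<exists>a. z1 \<le> i \<and> i \<in> I \<and> \<gamma> < h i \<longrightarrow> a \<in> A \<and> (\<forall>\<alpha>\<in>a. \<gamma> < f \<alpha> i)"
      using z1(2) by blast
    then obtain a where a: "\<And>i \<gamma>. z1 \<le> i \<Longrightarrow> i \<in> I \<Longrightarrow> \<gamma> < h i \<Longrightarrow> a i \<gamma> \<in> A"
      "\<And>i \<gamma> \<alpha>. z1 \<le> i \<Longrightarrow> i \<in> I \<Longrightarrow> \<gamma> < h i \<Longrightarrow> \<alpha> \<in> a i \<gamma> \<Longrightarrow> \<gamma> < f \<alpha> i"
      by metis
    have small: "|b| \<le>o |{..<\<kappa>}|" if "b \<in> A" for b using A(1) that ordLess_imp_ordLeq by blast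
    have supb: "\<exists>x<h j. \<forall>\<alpha>\<in>b. f \<alpha> j < x" if "b \<in> A" "j \<in> I" for b j
      using cf_gtD[OF h(2)[OF that(2)] small[OF that(1)], of "\<lambda>\<alpha>. f \<alpha> j"] f(1) A\<Lambda> that by blast
    define K where "K = {i \<in> I. z1 \<le> i}"
    \<comment> \<open>Two bounds in turn: over \<open>\<gamma> < h i\<close> because the cofinality
      of \<open>h j\<close> exceeds \<open>h i\<close>, then over \<open>i\<close> because it
      exceeds \<open>\<kappa>\<close>.\<close>
    have "\<exists>x. j \<in> I \<longrightarrow> x < h j \<and> (\<forall>i\<in>K. i < j \<longrightarrow> (\<forall>\<gamma><h i. \<forall>\<alpha>\<in>a i \<gamma>. f \<alpha> j < x))" for j
    proof (cases "j \<in> I")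
      case j: True
      have 1: "\<exists>x<h j. \<forall>\<gamma><h i. \<forall>\<alpha>\<in>a i \<gamma>. f \<alpha> j < x" if i: "i \<in> K" "i < j" for i
      proof -
        have "\<forall>\<gamma>. \<exists>x. \<gamma> < h i \<longrightarrow> x < h j \<and> (\<forall>\<alpha>\<in>a i \<gamma>. f \<alpha> j < x)"
          using supb[OF a(1) j] i(1) unfolding K_def by blast
        then obtain y where "\<forall>\<gamma>. \<gamma> < h i \<longrightarrow> y \<gamma> < h j \<and> (\<forall>\<alpha>\<in>a i \<gamma>. f \<alpha> j < y \<gamma>)"
          by (rule choice[THEN exE])
        then have y: "y \<gamma> < h j" "\<And>\<alpha>. \<alpha> \<in> a i \<gamma> \<Longrightarrow> f \<alpha> j < y \<gamma>" if "\<gamma> < h i" for \<gamma> using that by blast+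
        have "cf_gt {..<h i} (h j)" using h(3)[OF _ j i(2)] i(1) unfolding K_def by blast
        from cf_gtD[OF this ordIso_imp_ordLeq[OF card_of_refl], of y] obtain x
          where "x < h j" "\<forall>\<gamma>\<in>{..<h i}. y \<gamma> < x" using y(1) by blast
        then show ?thesis using y(2) by (meson lessThan_iff less_trans)
      qed
      then have "\<forall>i. \<exists>x. i \<in> K \<and> i < j \<longrightarrow> x < h j \<and> (\<forall>\<gamma><h i. \<forall>\<alpha>\<in>a i \<gamma>. f \<alpha> j < x)" by blast
      then obtain y where "\<forall>i. i \<in> K \<and> i < j \<longrightarrow> y i < h j \<and> (\<forall>\<gamma><h i. \<forall>\<alpha>\<in>a i \<gamma>. f \<alpha> j < y i)"
        by (rule choice[THEN exE])
      then have y: "y i < h j" "\<And>\<gamma> \<alpha>. \<gamma> < h i \<Longrightarrow> \<alpha> \<in> a i \<gamma> \<Longrightarrow> f \<alpha> j < y i" if "i \<in> K" "i < j" for i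
        using that by blast+
      have "|{i\<in>K. i < j}| \<le>o |{..<\<kappa>}|" using I(1) by (intro card_of_mono1) (auto simp: K_def)
      from cf_gtD[OF h(2)[OF j] this, of y] obtain x where x: "x < h j" "\<forall>i\<in>{i\<in>K. i < j}. y i < x"
        using y(1) by blast
      have "f \<alpha> j < x" if "i \<in> K" "i < j" "\<gamma> < h i" "\<alpha> \<in> a i \<gamma>" for i \<gamma> \<alpha>
        using y(2)[OF that] x(2) that(1,2) by (auto intro: less_trans)
      then show ?thesis using x(1) by blast
    qed blast
    then have "\<forall>j. \<exists>x. j \<in> I \<longrightarrow> x < h j \<and> (\<forall>i\<in>K. i < j \<longrightarrow> (\<forall>\<gamma><h i. \<forall>\<alpha>\<in>a i \<gamma>. f \<alpha> j < x))" by blast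
    then obtain g where g: "\<forall>j. j \<in> I \<longrightarrow> g j < h j \<and> (\<forall>i\<in>K. i < j \<longrightarrow> (\<forall>\<gamma><h i. \<forall>\<alpha>\<in>a i \<gamma>. f \<alpha> j < g j))"
      by (rule choice[THEN exE])
    \<comment> \<open>All chosen members together have at most \<open>|{..<\<mu>}|\<close> elements,
      so a later \<open>b\<close> can lie above every one of them.\<close>
    have "\<exists>x<\<Lambda>. \<forall>\<alpha>\<in>(\<Union>i\<in>K. \<Union>\<gamma>\<in>{..<h i}. a i \<gamma>). id \<alpha> < x"
    proof (rule cf_gtD[OF \<Lambda>_cf])
      have \<kappa>\<mu>: "|{..<\<kappa>}| \<le>o |{..<\<mu>}|" by (rule card_le_\<mu>[OF less_imp_le[OF \<kappa>_less]])
      have "|K| \<le>o |{..<\<mu>}|"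
        by (rule ordLeq_transitive[OF card_of_mono1 \<kappa>\<mu>]) (use I(1) K_def in auto)
      moreover have "|{..<h i}| \<le>o |{..<\<mu>}|" if "i \<in> K" for i
        using h(1)[of i] that by (intro card_le_\<mu>) (auto simp: K_def)
      moreover have "|a i \<gamma>| \<le>o |{..<\<mu>}|" if "i \<in> K" "\<gamma> < h i" for i \<gamma>
        using ordLeq_transitive[OF small[OF a(1)] \<kappa>\<mu>] that by (auto simp: K_def)
      ultimately show "|\<Union>i\<in>K. \<Union>\<gamma>\<in>{..<h i}. a i \<gamma>| \<le>o |{..<\<mu>}|"
        by (intro card_of_UNION_ordLeq_infinite[OF \<mu>_infinite] ballI) auto
      show "id \<alpha> < \<Lambda>" if "\<alpha> \<in> (\<Union>i\<in>K. \<Union>\<gamma>\<in>{..<h i}. a i \<gamma>)" for \<alpha>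
        using that A\<Lambda> a(1) by (auto simp: K_def)
    qed
    then obtain x where x: "x < \<Lambda>" "\<And>i \<gamma> \<alpha>. i \<in> K \<Longrightarrow> \<gamma> < h i \<Longrightarrow> \<alpha> \<in> a i \<gamma> \<Longrightarrow> \<alpha> < x" by auto
    obtain b where b: "b \<in> A" "\<And>\<beta>. \<beta> \<in> b \<Longrightarrow> x < \<beta>" "ev (\<lambda>j. j \<in> I \<longrightarrow> (\<forall>\<beta>\<in>b. g j < f \<beta> j))"
      using dom[of g, OF _ x(1)] g by blast
    then obtain z2 where z2: "z2 < \<kappa>" "\<And>j \<beta>. z2 \<le> j \<Longrightarrow> j \<in> I \<Longrightarrow> \<beta> \<in> b \<Longrightarrow> g j < f \<beta> j"
      using I(1) unfolding ev_def by blast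
    have "ev (\<lambda>i. z1 \<le> i \<and> z2 \<le> i)" by (intro ev_conj ev_ge z1(1) z2(1))
    then show ?thesis
    proof (rule ev_mono, intro impI)
      fix i assume zi: "z1 \<le> i \<and> z2 \<le> i" and i: "i \<in> I"
      then have iK: "i \<in> K" by (simp add: K_def)
      \<comment> \<open>With \<open>\<gamma>\<close> above all values of \<open>b\<close> at
        \<open>i\<close>, the member \<open>a i \<gamma>\<close> beats \<open>b\<close> at
        coordinate \<open>i\<close> and loses at every later one, separated there by
        \<open>g\<close>.\<close>
      obtain \<gamma> where \<gamma>: "\<gamma> < h i" "\<forall>\<beta>\<in>b. f \<beta> i < \<gamma>" using supb[OF b(1) i] by blast
      have "\<alpha> < \<beta> \<and> c \<alpha> \<beta> = i" if ab: "\<alpha> \<in> a i \<gamma>" "\<beta> \<in> b" for \<alpha> \<beta>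
      proof
        show "\<alpha> < \<beta>" using x(2)[OF iK \<gamma>(1) ab(1)] b(2)[OF ab(2)] by (rule less_trans)
        show "c \<alpha> \<beta> = i"
        proof (rule c_eq[OF i])
          show "\<not> f \<alpha> i < f \<beta> i"
            using a(2)[OF _ i \<gamma>(1) ab(1)] zi \<gamma>(2) ab(2) by (meson less_asym less_trans)
          fix j assume j: "j \<in> I" "i < j"
          have "f \<alpha> j < g j" using g j iK \<gamma>(1) ab(1) by blast
          moreover have "g j < f \<beta> j" using z2(2)[OF _ j(1) ab(2)] zi j(2) by auto
          ultimately show "f \<alpha> j < f \<beta> j" by (rule less_trans)
        qed
      qed
      then show "attains c A i"
        unfolding attains_def using a(1)[OF _ i \<gamma>(1)] zi b(1) by blast
    qed
  qed
  then show ?thesis using I by (intro exI[of _ I] exI[of _ c]) blast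
qed

text \<open>Map \<open>I\<close> onto \<open>{..<\<kappa>} \<times> Q\<close>. Every
  \<open>q\<close> then has \<open>\<kappa>\<close> many codes in \<open>I\<close>, an unbounded
  set, so one of them lies among the coordinates that the family attains.\<close>

lemma coded_colouring:
  fixes Q :: "'q set"
  assumes Q: "|Q| \<le>o |{..<\<kappa>}|" "Q \<noteq> {}"
  shows "\<exists>c. (\<forall>\<alpha> \<beta>. c \<alpha> \<beta> \<in> Q) \<and> (\<forall>A. large_family A \<longrightarrow> (\<forall>q\<in>Q. attains c A q))"
proof -
  obtain I c where I: "I \<subseteq> {..<\<kappa>}" "\<forall>x<\<kappa>. \<exists>i\<in>I. x < i"
    and c: "\<forall>A. large_family A \<longrightarrow> ev (\<lambda>i. i \<in> I \<longrightarrow> attains c A i)"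
    using last_coordinate_colouring by blast
  have unb: "\<exists>i\<in>B. x < i" if "x < \<kappa>" "|{..<\<kappa>}| \<le>o |B|" for B x
  proof (rule ccontr)
    assume "\<not> ?thesis"
    then have "B \<subseteq> {..x}" by (auto simp: not_less)
    then have "|B| <o |{..<\<kappa>}|" using card_of_mono1 card_atMost_\<kappa>[OF that(1)] ordLeq_ordLess_trans by blast
    then show False using that(2) not_ordLess_ordLeq by blast
  qed
  have I\<kappa>: "|{..<\<kappa>}| \<le>o |I|"
  proof (rule ccontr)
    assume "\<not> ?thesis"
    then have "|I| <o |{..<\<kappa>}|" by (simp add: not_ordLeq_iff_ordLess card_of_Well_order)
    from \<kappa>_regular[OF I(1) this] I(2) show False by (meson less_asym)
  qed
  have "|{..<\<kappa>} \<times> Q| =o |{..<\<kappa>}|" using card_of_Times_infinite[OF \<kappa>_infinite Q(2,1)] by blast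
  then have "|{..<\<kappa>} \<times> Q| \<le>o |I|" using I\<kappa> ordIso_ordLeq_trans by blast
  moreover have "{..<\<kappa>} \<noteq> {}" using \<kappa>_infinite by force
  then have "{..<\<kappa>} \<times> Q \<noteq> {}" using Q(2) by blast
  ultimately obtain \<phi> where \<phi>: "\<phi> ` I = {..<\<kappa>} \<times> Q"
    using card_of_ordLeq2[of "{..<\<kappa>} \<times> Q" I] by blast
  obtain q0 where q0: "q0 \<in> Q" using Q(2) by blast
  define d where "d \<alpha> \<beta> = (if c \<alpha> \<beta> \<in> I then snd (\<phi> (c \<alpha> \<beta>)) else q0)" for \<alpha> \<beta>
  have "d \<alpha> \<beta> \<in> Q" for \<alpha> \<beta>
  proof (cases "c \<alpha> \<beta> \<in> I")
    case True
    then have "\<phi> (c \<alpha> \<beta>) \<in> {..<\<kappa>} \<times> Q" using \<phi> by blast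
    then show ?thesis using True by (auto simp: d_def)
  qed (simp add: d_def q0)
  moreover have "attains d A q" if A: "large_family A" and q: "q \<in> Q" for A q
  proof -
    define B where "B = {i\<in>I. snd (\<phi> i) = q}"
    have "{..<\<kappa>} \<subseteq> (\<lambda>i. fst (\<phi> i)) ` B"
    proof
      fix x assume "x \<in> {..<\<kappa>}"
      then have "(x, q) \<in> \<phi> ` I" using \<phi> q by auto
      then obtain i where "i \<in> I" "\<phi> i = (x, q)" by (metis imageE)
      then show "x \<in> (\<lambda>i. fst (\<phi> i)) ` B" by (intro image_eqI[of _ _ i]) (auto simp: B_def)
    qed
    then have B: "|{..<\<kappa>}| \<le>o |B|" using surj_imp_ordLeq by blast
    obtain z where z: "z < \<kappa>" "\<And>i. z \<le> i \<Longrightarrow> i \<in> I \<Longrightarrow> attains c A i"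
      using c[rule_format, OF A] I(1) unfolding ev_def by blast
    obtain i where i: "i \<in> B" "z < i" using unb[OF z(1) B] by blast
    then have "attains c A i" using z(2)[of i] unfolding B_def by simp
    then obtain a b where ab: "a \<in> A" "b \<in> A" "\<forall>\<alpha>\<in>a. \<forall>\<beta>\<in>b. \<alpha> < \<beta> \<and> c \<alpha> \<beta> = i"
      unfolding attains_def by blast
    have "\<forall>\<alpha>\<in>a. \<forall>\<beta>\<in>b. \<alpha> < \<beta> \<and> d \<alpha> \<beta> = q" using ab(3) i(1) by (auto simp: B_def d_def)
    then show ?thesis unfolding attains_def using ab(1,2) by blast
  qed
  ultimately show ?thesis by blast
qed

end

section \<open>Transfer to cardinal well-orders\<close>

text \<open>A type carrying a well-order longer than every cardinal well-order on \<^typ>\<open>'a set\<close>.\<close>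

typedef 'a big = "UNIV :: 'a set set set" by simp

instantiation big :: (type) wellorder
begin

definition less_eq_big where
  "(x :: 'a big) \<le> y \<longleftrightarrow> (Rep_big x, Rep_big y) \<in> |UNIV :: 'a set set set|"

definition less_big where
  "(x :: 'a big) < y \<longleftrightarrow> x \<le> y \<and> x \<noteq> y"

instance
proof -
  let ?R = "|UNIV :: 'a set set set|"
  have wo: "well_order_on UNIV ?R" by (rule card_of_well_order_on)
  have lin: "refl ?R" "trans ?R" "antisym ?R" "total ?R" and wf: "wf (?R - Id)"
    using wo unfolding well_order_on_def linear_order_on_def partial_order_on_def preorder_on_def by auto
  show "OFCLASS('a big, wellorder_class)"
  proof
    fix x y z :: "'a big"
    show "x \<le> x" using lin(1) by (simp add: less_eq_big_def refl_on_def)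
    show "x \<le> y \<Longrightarrow> y \<le> z \<Longrightarrow> x \<le> z" using lin(2) by (auto simp: less_eq_big_def dest: transD)
    show anti: "x \<le> y \<Longrightarrow> y \<le> x \<Longrightarrow> x = y"
      using lin(3) by (auto simp: less_eq_big_def Rep_big_inject dest: antisymD)
    then show "(x < y) = (x \<le> y \<and> \<not> y \<le> x)"
      using lin(1) by (auto simp: less_big_def less_eq_big_def refl_on_def)
    show "x \<le> y \<or> y \<le> x"
      using lin(1,4) by (cases "x = y") (auto simp: less_eq_big_def total_on_def refl_on_def Rep_big_inject)
  next
    fix P :: "'a big \<Rightarrow> bool" and a
    assume step: "\<And>x. (\<And>y. y < x \<Longrightarrow> P y) \<Longrightarrow> P x"
    have "P (Abs_big u)" for u
      using wf
    proof (induction u rule: wf_induct_rule)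
      case (less u)
      show ?case
      proof (rule step)
        fix y :: "'a big" assume "y < Abs_big u"
        then have "(Rep_big y, u) \<in> ?R - Id"
          by (auto simp: less_big_def less_eq_big_def Abs_big_inverse Rep_big_inverse)
        from less[OF this] show "P y" by (simp add: Rep_big_inverse)
      qed
    qed
    from this[of "Rep_big a"] show "P a" by (simp add: Rep_big_inverse)
  qed
qed

end

definition le_big :: "'a big rel" where "le_big = {(x, y). x \<le> y}"

lemma well_order_on_le_big: "well_order_on UNIV (le_big :: 'a big rel)"
proof -
  have "(le_big :: 'a big rel) - Id = {(x, y). x < y}" by (auto simp: le_big_def)
  then have "wf ((le_big :: 'a big rel) - Id)" by (simp add: wf)
  then show ?thesis
    unfolding well_order_on_def linear_order_on_def partial_order_on_def preorder_on_def
    by (auto simp: le_big_def refl_on_def trans_def antisym_def total_on_def)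
qed

lemma Card_order_less_le_big:
  fixes s :: "'b rel"
  assumes "Card_order s" "|Field s| \<le>o |UNIV :: 'a set set|"
  shows "s <o (le_big :: 'a big rel)"
proof -
  have "s =o |Field s|" using assms(1) card_of_Field_ordIso ordIso_symmetric by blast
  moreover have "|UNIV :: 'a set set| <o |UNIV :: 'a set set set|"
    using card_of_Pow[of "UNIV :: 'a set set"] by simp
  moreover have "|UNIV :: 'a set set set| \<le>o |UNIV :: 'a big set|"
    using card_of_ordLeq[of "UNIV :: 'a set set set" "UNIV :: 'a big set"] Abs_big_inject
    by (auto intro!: exI[of _ Abs_big] inj_onI)
  moreover have "|UNIV :: 'a big set| \<le>o (le_big :: 'a big rel)"
    by (rule card_of_least[OF well_order_on_le_big])
  ultimately show ?thesis
    using assms(2) by (meson ordIso_ordLeq_trans ordLeq_ordLess_trans ordLess_ordLeq_trans)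
qed

text \<open>Being shorter than \<open>le_big\<close>, \<open>s\<close> is isomorphic to a proper
  initial segment; its end point is an initial ordinal because proper segments of a cardinal order
  are smaller.\<close>

lemma Card_order_as_segment:
  fixes s :: "'b rel"
  assumes s: "Card_order s" "s <o (le_big :: 'a big rel)"
  shows "\<exists>(L :: 'a big) \<phi>. bij_betw \<phi> (Field s) {..<L} \<and>
    (\<forall>a\<in>Field s. \<forall>b\<in>Field s. (a, b) \<in> s \<longleftrightarrow> \<phi> a \<le> \<phi> b) \<and> |{..<L}| =o s \<and>
    (\<forall>x<L. |{..<x}| <o |{..<L}| )"
proof -
  let ?B = "le_big :: 'a big rel"
  have WB: "Well_order ?B" and FB: "Field ?B = UNIV"
    using well_order_on_le_big well_order_on_Well_order by blast+
  have Ws: "Well_order s" using s(1) by (simp add: card_order_on_def)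
  obtain L where L: "s =o Restr ?B (underS ?B L)"
    using s(2) ordLess_iff_ordIso_Restr[OF WB Ws] by blast
  have uB: "underS ?B L = {..<L}" by (auto simp: underS_def le_big_def)
  have FR: "Field (Restr ?B {..<L}) = {..<L}"
    by (auto simp: Field_def le_big_def)
  obtain \<phi> where "iso s (Restr ?B {..<L}) \<phi>" using L uB unfolding ordIso_def by auto
  then have bij: "bij_betw \<phi> (Field s) {..<L}"
    and ord: "\<And>a b. a \<in> Field s \<Longrightarrow> b \<in> Field s \<Longrightarrow> (a, b) \<in> s \<longleftrightarrow> (\<phi> a, \<phi> b) \<in> Restr ?B {..<L}"
    unfolding iso_iff2 FR by auto
  have ord': "(a, b) \<in> s \<longleftrightarrow> \<phi> a \<le> \<phi> b" if "a \<in> Field s" "b \<in> Field s" for a b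
    using ord[OF that] bij_betwE[OF bij] that by (auto simp: le_big_def)
  have card: "|{..<L}| =o s"
    using card_of_ordIsoI[OF bij] card_of_Field_ordIso[OF s(1)] ordIso_symmetric ordIso_transitive by blast
  have "|{..<x}| <o |{..<L}|" if x: "x < L" for x
  proof -
    obtain a where a: "a \<in> Field s" "\<phi> a = x" using bij x unfolding bij_betw_def by (metis imageE lessThan_iff)
    have "{..<x} \<subseteq> \<phi> ` underS s a"
    proof
      fix y assume y: "y \<in> {..<x}"
      then have "y \<in> {..<L}" using x by auto
      then obtain b where b: "b \<in> Field s" "\<phi> b = y" using bij unfolding bij_betw_def by (metis imageE)
      have "b \<in> underS s a" using ord'[OF b(1) a(1)] y a(2) b(2) by (auto simp: underS_def)
      then show "y \<in> \<phi> ` underS s a" using b(2) by blast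
    qed
    then have "|{..<x}| \<le>o |underS s a|" by (rule surj_imp_ordLeq)
    moreover have "|underS s a| <o s" using card_of_underS[OF s(1) a(1)] .
    ultimately show ?thesis using card ordIso_symmetric ordLeq_ordLess_trans ordLess_ordIso_trans by blast
  qed
  then show ?thesis using bij ord' card by blast
qed

section \<open>Size of the codes, and the singular cardinal as a segment\<close>

lemma card_of_lists_ordLeq:
  assumes "infinite A"
  shows "|{zs. set zs \<subseteq> A}| \<le>o |A|"
proof -
  have len: "|{zs. set zs \<subseteq> A \<and> length zs = n}| \<le>o |A|" for n
  proof (induction n)
    case 0
    have "{zs. set zs \<subseteq> A \<and> length zs = 0} = {[]}" by auto
    then show ?case using assms by (auto intro: card_of_singl_ordLeq)
  next
    case (Suc n)
    let ?L = "{zs. set zs \<subseteq> A \<and> length zs = n}"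
    have "{zs. set zs \<subseteq> A \<and> length zs = Suc n} \<subseteq> (\<lambda>(x, xs). x # xs) ` (A \<times> ?L)"
      by (auto simp: length_Suc_conv image_iff)
    then have "|{zs. set zs \<subseteq> A \<and> length zs = Suc n}| \<le>o |A \<times> ?L|" by (rule surj_imp_ordLeq)
    moreover have "|A \<times> ?L| \<le>o |A|"
      using Suc assms ordIso_imp_ordLeq[OF card_of_refl[of A]] by (intro card_of_Sigma_ordLeq_infinite) auto
    ultimately show ?case using ordLeq_transitive by blast
  qed
  have "|\<Union>n. {zs. set zs \<subseteq> A \<and> length zs = n}| \<le>o |A|"
    using len by (intro card_of_UNION_ordLeq_infinite[OF assms card_of_nat_ordLeq[OF assms]]) simp
  moreover have "(\<Union>n. {zs. set zs \<subseteq> A \<and> length zs = n}) = {zs. set zs \<subseteq> A}" by auto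
  ultimately show ?thesis by simp
qed

text \<open>\<open>t\<close> enumerates the image of a cofinal set of least size. Failure of
  regularity gives a cofinal set smaller than \<open>r\<close>, whence
  \<open>\<kappa> < \<mu>\<close>.\<close>

lemma singular_segments:
  fixes r :: "'a rel" and c :: "'c rel"
  assumes mu_card: "Card_order r" and mu_infinite: "infinite (Field r)"
    and mu_singular: "\<not> regularCard r"
    and c_card: "Card_order c" and c_cf: "has_cf_card r (Field c)"
  shows "\<exists>(\<kappa> :: 'a big) \<mu> \<Lambda> t \<phi>. singular \<kappa> \<mu> \<Lambda> t \<and> |{..<\<kappa>}| =o c \<and> |{..<\<mu>}| =o r \<and>
    bij_betw \<phi> (Field (cardSuc r)) {..<\<Lambda>} \<and>
    (\<forall>a\<in>Field (cardSuc r). \<forall>b\<in>Field (cardSuc r). (a, b) \<in> cardSuc r \<longleftrightarrow> \<phi> a \<le> \<phi> b)"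
proof -
  have cF: "|Field c| =o c" using c_card by (rule card_of_Field_ordIso)
  have rF: "|Field r| =o r" using mu_card by (rule card_of_Field_ordIso)
  obtain K where K: "K \<subseteq> Field r" "cofinal K r" "|K| =o |Field c|"
    using c_cf unfolding has_cf_card_def by blast
  have cmin: "|Field c| \<le>o |B|" if "B \<subseteq> Field r" "cofinal B r" for B
    using c_cf that unfolding has_cf_card_def by blast
  have csuc: "Card_order (cardSuc r)" using mu_card by (rule cardSuc_Card_order)
  have kbig: "cardSuc r <o (le_big :: 'a big rel)"
    by (rule Card_order_less_le_big[OF csuc]) (rule card_of_mono1, simp)
  have rbig: "r <o (le_big :: 'a big rel)"
    using cardSuc_greater[OF mu_card] kbig ordLess_transitive by blast
  have "c \<le>o r"
    using ordIso_symmetric[OF cF] ordIso_symmetric[OF K(3)] card_of_mono1[OF K(1)] rF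
    by (meson ordIso_ordLeq_trans ordIso_transitive ordLeq_ordIso_trans)
  then have cbig: "c <o (le_big :: 'a big rel)" using rbig ordLeq_ordLess_trans by blast
  obtain \<Lambda> :: "'a big" and \<phi> where \<Lambda>: "bij_betw \<phi> (Field (cardSuc r)) {..<\<Lambda>}"
    "\<forall>a\<in>Field (cardSuc r). \<forall>b\<in>Field (cardSuc r). (a, b) \<in> cardSuc r \<longleftrightarrow> \<phi> a \<le> \<phi> b"
    "|{..<\<Lambda>}| =o cardSuc r" "\<forall>x<\<Lambda>. |{..<x}| <o |{..<\<Lambda>}|"
    using Card_order_as_segment[OF csuc kbig] by blast
  obtain \<mu> :: "'a big" and \<psi> where \<mu>: "bij_betw \<psi> (Field r) {..<\<mu>}"
    "\<forall>a\<in>Field r. \<forall>b\<in>Field r. (a, b) \<in> r \<longleftrightarrow> \<psi> a \<le> \<psi> b"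
    "|{..<\<mu>}| =o r" "\<forall>x<\<mu>. |{..<x}| <o |{..<\<mu>}|"
    using Card_order_as_segment[OF mu_card rbig] by blast
  obtain \<kappa> :: "'a big" where \<kappa>: "|{..<\<kappa>}| =o c" "\<forall>x<\<kappa>. |{..<x}| <o |{..<\<kappa>}|"
    using Card_order_as_segment[OF c_card cbig] by blast
  have \<psi>_image: "\<psi> ` Field r = {..<\<mu>}" and \<psi>_inj: "inj_on \<psi> (Field r)"
    using \<mu>(1) unfolding bij_betw_def by auto
  have \<psi>K: "\<exists>b\<in>\<psi> ` K. x < b" if x: "x < \<mu>" for x
  proof -
    obtain a where a: "a \<in> Field r" "\<psi> a = x" using x \<psi>_image by (metis imageE lessThan_iff)
    obtain b where b: "b \<in> K" "a \<noteq> b" "(a, b) \<in> r" using K(2) a(1) unfolding cofinal_def by blast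
    have "b \<in> Field r" using b(1) K(1) by blast
    then have "\<psi> a < \<psi> b"
      using \<mu>(2) a(1) b(2,3) \<psi>_inj by (metis inj_onD order.not_eq_order_implies_strict)
    then show ?thesis using a(2) b(1) by blast
  qed
  have \<psi>K_sub: "\<psi> ` K \<subseteq> {..<\<mu>}" using K(1) \<psi>_image by blast
  have \<mu>inf: "infinite {..<\<mu>}" using mu_infinite \<mu>(1) bij_betw_finite by blast
  then obtain x0 where x0: "x0 < \<mu>" by (metis finite.emptyI lessThan_iff subset_empty subsetI)
  have infK: "infinite (\<psi> ` K)"
  proof
    assume fin: "finite (\<psi> ` K)"
    have "\<psi> ` K \<noteq> {}" using \<psi>K[OF x0] by blast
    then have "Max (\<psi> ` K) \<in> \<psi> ` K" using fin by (rule Max_in[rotated])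
    then obtain b where "b \<in> \<psi> ` K" "Max (\<psi> ` K) < b" using \<psi>K \<psi>K_sub by blast
    then show False using Max_ge[OF fin] by (simp add: not_le[symmetric])
  qed
  have \<kappa>c: "|{..<\<kappa>}| =o |Field c|" using \<kappa>(1) cF ordIso_symmetric ordIso_transitive by blast
  have K\<kappa>: "|\<psi> ` K| \<le>o |{..<\<kappa>}|"
    using card_of_image[of \<psi> K] K(3) \<kappa>c by (meson ordIso_symmetric ordLeq_ordIso_trans)
  have "\<psi> ` K \<noteq> {}" using infK by force
  then obtain t where t: "t ` {..<\<kappa>} = \<psi> ` K" using card_of_ordLeq2[of "\<psi> ` K" "{..<\<kappa>}"] K\<kappa> by meson
  have "singular \<kappa> \<mu> \<Lambda> t"
  proof
    show "infinite {..<\<kappa>}" using card_of_ordLeq_infinite[OF K\<kappa> infK] .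
    show "|{..<i}| <o |{..<\<kappa>}|" if "i < \<kappa>" for i using \<kappa>(2) that by blast
    show "|{..<i}| <o |{..<\<mu>}|" if "i < \<mu>" for i using \<mu>(4) that by blast
    show "t i < \<mu>" if "i < \<kappa>" for i using t \<psi>K_sub that by blast
    show "\<exists>i<\<kappa>. x \<le> t i" if x: "x < \<mu>" for x
    proof -
      obtain b where "b \<in> t ` {..<\<kappa>}" "x < b" using \<psi>K[OF x] t by auto
      then show ?thesis by (auto intro: less_imp_le)
    qed
    show "\<kappa> < \<mu>"
    proof -
      obtain B where B: "B \<subseteq> Field r" "cofinal B r" "\<not> |B| =o r"
        using mu_singular unfolding regularCard_def by blast
      have "|B| \<le>o r" using card_of_mono1[OF B(1)] rF ordLeq_ordIso_trans by blast
      then have "|B| <o r" using B(3) ordLeq_iff_ordLess_or_ordIso by blast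
      then have "|Field c| <o r" using cmin[OF B(1,2)] ordLeq_ordLess_trans by blast
      then have "|{..<\<kappa>}| <o |{..<\<mu>}|"
        using \<kappa>c \<mu>(3) by (meson ordIso_ordLess_trans ordIso_symmetric ordLess_ordIso_trans)
      then show ?thesis by (rule less_of_card_less)
    qed
    show "\<exists>x<\<mu>. \<forall>b\<in>B. b < x" if B: "B \<subseteq> {..<\<mu>}" "|B| <o |{..<\<kappa>}|" for B
    proof (rule ccontr)
      assume no: "\<not> ?thesis"
      \<comment> \<open>An unbounded \<open>B\<close> pulls back to a cofinal subset of
        \<open>r\<close>, which cannot be smaller than the cofinality.\<close>
      define D where "D = {a \<in> Field r. \<psi> a \<in> B}"
      have "cofinal D r" unfolding cofinal_def
      proof
        fix a assume a: "a \<in> Field r"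
        then have "\<psi> a < \<mu>" using \<psi>_image by auto
        then obtain x where x: "x < \<mu>" "\<psi> a < x" using \<psi>K \<psi>K_sub by blast
        obtain y where y: "y \<in> B" "x \<le> y" using no x(1) by (meson not_less)
        obtain b where b: "b \<in> Field r" "\<psi> b = y" using B(1) y(1) \<psi>_image by (metis imageE subsetD)
        have "\<psi> a < \<psi> b" using x(2) y(2) b(2) by simp
        then have "a \<noteq> b" "(a, b) \<in> r" using \<mu>(2) a b(1) by (auto intro: less_imp_le)
        then show "\<exists>b\<in>D. a \<noteq> b \<and> (a, b) \<in> r" using b y(1) unfolding D_def by blast
      qed
      then have "|Field c| \<le>o |D|" by (intro cmin) (auto simp: D_def)
      moreover have "|D| \<le>o |B|"
        using \<psi>_inj card_of_ordLeq[of D B] unfolding D_def by (auto intro!: exI[of _ \<psi>] simp: inj_on_def)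
      ultimately have "|{..<\<kappa>}| \<le>o |B|" using \<kappa>c by (meson ordIso_ordLeq_trans ordLeq_transitive)
      then show False using B(2) not_ordLess_ordLeq by blast
    qed
    show "succ_card \<mu> \<Lambda>" unfolding succ_card_def
    proof (intro conjI allI impI)
      show "|{..<\<mu>}| <o |{..<\<Lambda>}|"
        using \<mu>(3) cardSuc_greater[OF mu_card] \<Lambda>(3)
        by (meson ordIso_ordLess_trans ordIso_symmetric ordLess_ordIso_trans)
      fix z assume "z < \<Lambda>"
      then have "|{..<z}| <o cardSuc r" using \<Lambda>(3,4) ordLess_ordIso_trans by blast
      then have "|{..<z}| \<le>o r" using cardSuc_ordLeq_ordLess[OF mu_card card_of_Card_order] by blast
      then show "|{..<z}| \<le>o |{..<\<mu>}|" using \<mu>(3) ordIso_symmetric ordLeq_ordIso_trans by blast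
    qed (fact \<mu>inf)
  qed
  then show ?thesis using \<kappa>(1) \<mu>(3) \<Lambda>(1,2) by blast
qed

theorem theorem4p7:
  fixes r :: "'a rel" and c :: "'c rel"
    and n :: "'c \<Rightarrow> nat" and p :: "'c \<Rightarrow> 'a set \<Rightarrow> 'a set \<Rightarrow> nat"
  assumes mu_card: "Card_order r"
    and mu_infinite: "infinite (Field r)"
    and mu_singular: "\<not> regularCard r"
    and c_card: "Card_order c"
    and c_cf: "has_cf_card r (Field c)"
    and p_part: "\<forall>\<delta>\<in>Field c. \<forall>\<alpha>\<in>Field (cardSuc r). \<forall>\<beta>\<in>Field (cardSuc r).
                   ord_less (cardSuc r) \<alpha> \<beta> \<longrightarrow> p \<delta> \<alpha> \<beta> < n \<delta>"
  shows "Pr1_seq (cardSuc r) (cardSuc r) (Field c) c p n (Field c)"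
proof -
  let ?k = "cardSuc r"
  obtain \<kappa> \<mu> \<Lambda> :: "'a big" and t \<phi> where S: "singular \<kappa> \<mu> \<Lambda> t"
    and \<kappa>: "|{..<\<kappa>}| =o c" and \<mu>: "|{..<\<mu>}| =o r"
    and \<phi>: "bij_betw \<phi> (Field ?k) {..<\<Lambda>}"
    and ord: "\<forall>a\<in>Field ?k. \<forall>b\<in>Field ?k. (a, b) \<in> ?k \<longleftrightarrow> \<phi> a \<le> \<phi> b"
    using singular_segments[OF mu_card mu_infinite mu_singular c_card c_cf] by blast
  interpret singular \<kappa> \<mu> \<Lambda> t by (rule S)
  have cF: "|Field c| =o |{..<\<kappa>}|"
    using card_of_Field_ordIso[OF c_card] \<kappa> ordIso_symmetric ordIso_transitive by blast
  have cinf: "infinite (Field c)" using \<kappa>_infinite card_of_ordIso_finite[OF cF] by blast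
  \<comment> \<open>A code names the partition to be read and lists the colours wanted for its
    finitely many classes.\<close>
  define Q where "Q = Field c \<times> {zs. set zs \<subseteq> Field c}"
  have "|Q| \<le>o |Field c|"
    unfolding Q_def using card_of_lists_ordLeq[OF cinf] cinf ordIso_imp_ordLeq[OF card_of_refl[of "Field c"]]
    by (intro card_of_Sigma_ordLeq_infinite) auto
  then have "|Q| \<le>o |{..<\<kappa>}|" using cF ordLeq_ordIso_trans by blast
  moreover obtain c0 where c0: "c0 \<in> Field c" using cinf by force
  moreover then have "Q \<noteq> {}" by (auto simp: Q_def intro!: exI[of _ "[]"])
  ultimately obtain d where dQ: "\<forall>\<alpha> \<beta>. d \<alpha> \<beta> \<in> Q"
    and d: "\<forall>A. large_family A \<longrightarrow> (\<forall>q\<in>Q. attains d A q)"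
    using coded_colouring[of Q] by blast
  \<comment> \<open>Decoding looks up the class of the pair under the named partition;
    \<open>c0\<close> is returned when the list is too short.\<close>
  define f where "f \<alpha> \<beta> = (let (\<delta>, zs) = d (\<phi> \<alpha>) (\<phi> \<beta>); m = p \<delta> \<alpha> \<beta>
    in if m < length zs then zs ! m else c0)" for \<alpha> \<beta>
  have fc: "f \<alpha> \<beta> \<in> Field c" for \<alpha> \<beta>
  proof -
    obtain \<delta> zs where dd: "d (\<phi> \<alpha>) (\<phi> \<beta>) = (\<delta>, zs)" by (cases "d (\<phi> \<alpha>) (\<phi> \<beta>)")
    then have "set zs \<subseteq> Field c" using dQ[rule_format, of "\<phi> \<alpha>" "\<phi> \<beta>"] by (simp add: Q_def)
    then show ?thesis using c0 dd nth_mem[of "p \<delta> \<alpha> \<beta>" zs] by (auto simp: f_def Let_def)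
  qed
  have \<phi>_inj: "inj_on \<phi> (Field ?k)" and \<phi>_image: "\<phi> ` Field ?k = {..<\<Lambda>}"
    using \<phi> unfolding bij_betw_def by auto
  have main: "\<exists>a\<in>A. \<exists>b\<in>A. \<forall>\<alpha>\<in>a. \<forall>\<beta>\<in>b. ord_less ?k \<alpha> \<beta> \<and> f \<alpha> \<beta> = \<zeta> (p \<delta> \<alpha> \<beta>)"
    if \<delta>: "\<delta> \<in> Field c" and Ax: "\<forall>a\<in>A. a \<subseteq> Field ?k \<and> |a| <o Restr c (underS c \<xi>)"
      and A: "|A| =o ?k" "pairwise disjnt A" "{} \<notin> A" and \<zeta>: "\<zeta> ` {..<n \<delta>} \<subseteq> Field c"
    for \<delta> \<xi> A and \<zeta> :: "nat \<Rightarrow> 'c"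
  proof -
    have Ak: "a \<subseteq> Field ?k" if "a \<in> A" for a using Ax that by blast
    have Wc: "Well_order c" "Field c \<noteq> {}" using c_card cinf by (auto simp: card_order_on_def)
    have small: "|\<phi> ` a| <o |{..<\<kappa>}|" if "a \<in> A" for a
    proof -
      have "|a| <o c" using Ax that underS_Restr_ordLess[OF Wc] ordLess_transitive by blast
      then have "|a| <o |{..<\<kappa>}|" using \<kappa> ordIso_symmetric ordLess_ordIso_trans by blast
      then show ?thesis using card_of_image ordLeq_ordLess_trans by blast
    qed
    have inj: "inj_on ((`) \<phi>) A"
      using Ak by (intro inj_onI) (metis \<phi>_inj inj_on_image_eq_iff)
    have "|{..<\<mu>}| <o |(`) \<phi> ` A|"
    proof -
      have "|A| \<le>o |(`) \<phi> ` A|" using inj card_of_ordLeq by blast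
      moreover have "|{..<\<mu>}| <o |A|"
        using \<mu> cardSuc_greater[OF mu_card] A(1)
        by (meson ordIso_ordLess_trans ordIso_symmetric ordLess_ordIso_trans)
      ultimately show ?thesis using ordLess_ordLeq_trans by blast
    qed
    moreover have "pairwise disjnt ((`) \<phi> ` A)"
    proof -
      have "disjnt (\<phi> ` a) (\<phi> ` b)" if "a \<in> A" "b \<in> A" "a \<noteq> b" for a b
      proof -
        have "disjnt a b" using A(2) that by (auto simp: pairwise_def)
        then show ?thesis
          using inj_on_image_Int[OF \<phi>_inj Ak[OF that(1)] Ak[OF that(2)]] by (simp add: disjnt_def)
      qed
      then show ?thesis by (auto simp: pairwise_def)
    qed
    moreover have "\<forall>a\<in>(`) \<phi> ` A. a \<subseteq> {..<\<Lambda>} \<and> |a| <o |{..<\<kappa>}|"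
      using small Ak \<phi>_image by blast
    moreover have "{} \<notin> (`) \<phi> ` A" using A(3) by auto
    ultimately have "large_family ((`) \<phi> ` A)" unfolding large_family_def by blast
    \<comment> \<open>This list has length \<open>n \<delta>\<close>, so every class of a pair under
      \<open>p \<delta>\<close> finds its colour in it.\<close>
    moreover have "(\<delta>, map \<zeta> [0..<n \<delta>]) \<in> Q" using \<delta> \<zeta> by (auto simp: Q_def)
    ultimately have "attains d ((`) \<phi> ` A) (\<delta>, map \<zeta> [0..<n \<delta>])" using d by blast
    then obtain a b where ab: "a \<in> A" "b \<in> A"
      "\<And>\<alpha> \<beta>. \<alpha> \<in> a \<Longrightarrow> \<beta> \<in> b \<Longrightarrow> \<phi> \<alpha> < \<phi> \<beta> \<and> d (\<phi> \<alpha>) (\<phi> \<beta>) = (\<delta>, map \<zeta> [0..<n \<delta>])"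
      unfolding attains_def by blast
    have "ord_less ?k \<alpha> \<beta> \<and> f \<alpha> \<beta> = \<zeta> (p \<delta> \<alpha> \<beta>)" if "\<alpha> \<in> a" "\<beta> \<in> b" for \<alpha> \<beta>
    proof
      have F: "\<alpha> \<in> Field ?k" "\<beta> \<in> Field ?k" using Ak ab(1,2) that by blast+
      show less: "ord_less ?k \<alpha> \<beta>"
        using ord F ab(3)[OF that] unfolding ord_less_def by (auto intro: less_imp_le)
      then have "p \<delta> \<alpha> \<beta> < n \<delta>" using p_part \<delta> F by blast
      then show "f \<alpha> \<beta> = \<zeta> (p \<delta> \<alpha> \<beta>)" using ab(3)[OF that] by (simp add: f_def)
    qed
    then show ?thesis using ab(1,2) by blast
  qed
  show ?thesis
    unfolding Pr1_seq_def
  proof (intro exI[of _ f] conjI ballI allI impI)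
    fix \<delta> \<xi> A and \<zeta> :: "nat \<Rightarrow> 'c"
    assume "\<delta> \<in> Field c" "\<zeta> ` {..<n \<delta>} \<subseteq> Field c"
      "(\<forall>a\<in>A. a \<subseteq> Field ?k \<and> |a| <o Restr c (underS c \<xi>)) \<and> |A| =o ?k \<and> pairwise disjnt A \<and> {} \<notin> A"
    then show "\<exists>a\<in>A. \<exists>b\<in>A. \<forall>\<alpha>\<in>a. \<forall>\<beta>\<in>b. ord_less ?k \<alpha> \<beta> \<and> f \<alpha> \<beta> = \<zeta> (p \<delta> \<alpha> \<beta>)"
      by (elim conjE) (rule main)
  qed (rule fc)
qed

end
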